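(* Let $A$ be a self-adjoint operator on an infinite-dimensional Hilbert space $\mathcal{H}$ with dense domain $\mathrm{Dom}(A)$. Let $\lambda\in\mathrm{Spec}_{\mathrm{disc}}(A)$ and let $d:=\mathrm{dist}[\lambda,\mathrm{Spec}(A)\setminus\{\lambda\}]$. Let $(\mathcal{L}_n)_n$ be a sequence of subspaces of $\mathrm{Dom}(A)$, with $\dim\mathcal{L}_n=n$, each equipped with an orthonormal basis, and suppose that the sequence satisfies condition (H) for $\lambda$ (stated in the context). Then for every $\delta$ with $0<\delta<d/4$ there exist $N,\varepsilon_0,\varepsilon_1,\varepsilon_2>0$ ensuring the following. If $n>N$ and the matrices $\tilde A_0,\tilde A_1,\tilde A_2\in\mathbb{C}^{n\times n}$ satisfy $$\|\tilde A_p-A_p^{(n)}\|<\varepsilon_p,\qquad p=0,1,2,$$ then: (a) there exists $\zeta\in\mathbb{C}$ with $\det[\tilde A_0-2\zeta\tilde A_1+\zeta^2\tilde A_2]=0$ and $|\zeta-\lambda|<\delta$; (b) the set $\{\mu\in\mathbb{C}:\det[\tilde A_0-2\mu\tilde A_1+\mu^2\tilde A_2]=0\}$ does not intersect the annulus $\{w\in\mathbb{C}:\delta<|w-\lambda|\le d/4\}$.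
   Context: $\mathrm{Spec}_{\mathrm{disc}}(A)$ is the set of isolated points of $\mathrm{Spec}(A)$ that are eigenvalues of finite multiplicity. The inner product is linear in the first argument. For each $n$, $\mathcal{L}_n\subset\mathrm{Dom}(A)$ is an $n$-dimensional subspace with orthonormal basis $\{e_1,\dots,e_n\}=\{e^{(n)}_1,\dots,e^{(n)}_n\}$ (the basis depends on $n$; the subspaces are not assumed to be nested), and $\Pi_n$ is the orthogonal projection onto $\mathcal{L}_n$. The matrices $A_p^{(n)}\in\mathbb{C}^{n\times n}$ are $$[A_0^{(n)}]_{jk}=\langle Ae_j,Ae_k\rangle,\quad [A_1^{(n)}]_{jk}=\langle Ae_j,e_k\rangle,\quad [A_2^{(n)}]_{jk}=\langle e_j,e_k\rangle .$$ Matrix norms are operator norms induced by the Euclidean norm. Condition (H) for $\lambda$: for all $p,q\in\{0,1\}$ and all $u\in\mathrm{Dom}(A)$ with $Au=\lambda u$, $$\Big\|\sum_{j=1}^n\langle A^p\Pi_nu,A^qe_j\rangle e_j-\lambda^{p+q}u\Big\|\to0\quad\text{as }n\to\infty .$$ *)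

theory Defs
  imports "HOL-Analysis.Analysis" "Jordan_Normal_Form.Determinant"
begin

text \<open>Complex Hilbert spaces. The real vector space structure, the norm and completeness come
  from \<^class>\<open>banach\<close>; the last axiom says that the norm is the one given by the inner product
  (and so makes the latter positive definite). The inner product is linear in its first
  argument.\<close>

class complex_hilbert = banach +
  fixes scaleC :: "complex \<Rightarrow> 'a \<Rightarrow> 'a" (infixr \<open>*\<^sub>C\<close> 75)
    and cinner :: "'a \<Rightarrow> 'a \<Rightarrow> complex"
  assumes scaleC_add_right: "c *\<^sub>C (x + y) = c *\<^sub>C x + c *\<^sub>C y"
    and scaleC_add_left: "(b + c) *\<^sub>C x = b *\<^sub>C x + c *\<^sub>C x"
    and scaleC_scaleC: "b *\<^sub>C (c *\<^sub>C x) = (b * c) *\<^sub>C x"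
    and scaleC_one: "1 *\<^sub>C x = x"
    and scaleR_scaleC: "scaleR r x = complex_of_real r *\<^sub>C x"
    and cinner_commute: "cinner x y = cnj (cinner y x)"
    and cinner_add_left: "cinner (x + y) z = cinner x z + cinner y z"
    and cinner_scaleC_left: "cinner (c *\<^sub>C x) y = c * cinner x y"
    and cinner_self: "cinner x x = complex_of_real ((norm x)\<^sup>2)"

global_interpretation complex_vector: vector_space "scaleC :: complex \<Rightarrow> 'a \<Rightarrow> 'a::complex_hilbert"
  defines csubspace = complex_vector.subspace
    and cspan = complex_vector.span
    and cdim = complex_vector.dim
  by unfold_locales (simp_all add: scaleC_add_right scaleC_add_left scaleC_scaleC scaleC_one)

definition finite_dimensional :: "'a::complex_hilbert set \<Rightarrow> bool" where
  "finite_dimensional V \<longleftrightarrow> (\<exists>B. finite B \<and> V \<subseteq> cspan B)"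

text \<open>An operator with domain \<open>D\<close> is represented by \<open>D\<close> together with a total function \<open>A\<close> whose
  values outside \<open>D\<close> are irrelevant.\<close>

definition linear_operator :: "'a::complex_hilbert set \<Rightarrow> ('a \<Rightarrow> 'a) \<Rightarrow> bool" where
  "linear_operator D A \<longleftrightarrow> csubspace D \<and>
     (\<forall>u\<in>D. \<forall>v\<in>D. A (u + v) = A u + A v) \<and> (\<forall>c. \<forall>u\<in>D. A (c *\<^sub>C u) = c *\<^sub>C A u)"

definition operator_graph :: "'a::complex_hilbert set \<Rightarrow> ('a \<Rightarrow> 'a) \<Rightarrow> ('a \<times> 'a) set" where
  "operator_graph D A = {(u, A u) |u. u \<in> D}"

definition adjoint_graph :: "'a::complex_hilbert set \<Rightarrow> ('a \<Rightarrow> 'a) \<Rightarrow> ('a \<times> 'a) set" where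
  "adjoint_graph D A = {(v, w). \<forall>u\<in>D. cinner (A u) v = cinner u w}"

definition self_adjoint :: "'a::complex_hilbert set \<Rightarrow> ('a \<Rightarrow> 'a) \<Rightarrow> bool" where
  "self_adjoint D A \<longleftrightarrow> linear_operator D A \<and> closure D = UNIV \<and>
     operator_graph D A = adjoint_graph D A"

text \<open>A point \<open>z\<close> is in the resolvent set if \<open>A - z\<close> maps \<open>D\<close> bijectively onto the whole space and
  has a bounded inverse.\<close>

definition resolvent_set :: "'a::complex_hilbert set \<Rightarrow> ('a \<Rightarrow> 'a) \<Rightarrow> complex set" where
  "resolvent_set D A = {z. bij_betw (\<lambda>u. A u - z *\<^sub>C u) D UNIV \<and>
     (\<exists>C. \<forall>u\<in>D. norm u \<le> C * norm (A u - z *\<^sub>C u))}"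

definition Spec :: "'a::complex_hilbert set \<Rightarrow> ('a \<Rightarrow> 'a) \<Rightarrow> complex set" where
  "Spec D A = - resolvent_set D A"

definition eigenspace :: "'a::complex_hilbert set \<Rightarrow> ('a \<Rightarrow> 'a) \<Rightarrow> complex \<Rightarrow> 'a set" where
  "eigenspace D A z = {u \<in> D. A u = z *\<^sub>C u}"

definition Spec_disc :: "'a::complex_hilbert set \<Rightarrow> ('a \<Rightarrow> 'a) \<Rightarrow> complex set" where
  "Spec_disc D A = {z. z isolated_in Spec D A \<and>
     (\<exists>u\<in>eigenspace D A z. u \<noteq> 0) \<and> finite_dimensional (eigenspace D A z)}"

definition orthonormal_basis :: "nat \<Rightarrow> (nat \<Rightarrow> 'a::complex_hilbert) \<Rightarrow> 'a set \<Rightarrow> bool" where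
  "orthonormal_basis n e L \<longleftrightarrow>
     (\<forall>j<n. \<forall>k<n. cinner (e j) (e k) = (if j = k then 1 else 0)) \<and> cspan (e ` {..<n}) = L"

definition orth_proj :: "'a::complex_hilbert set \<Rightarrow> 'a \<Rightarrow> 'a" where
  "orth_proj L u = (THE v. v \<in> L \<and> (\<forall>w\<in>L. cinner (u - v) w = 0))"

text \<open>The basis of the \<open>n\<close>-th subspace \<open>L n\<close> is \<open>e n 0, \<dots>, e n (n - 1)\<close>.\<close>

definition condition_H ::
  "'a::complex_hilbert set \<Rightarrow> ('a \<Rightarrow> 'a) \<Rightarrow> (nat \<Rightarrow> 'a set) \<Rightarrow> (nat \<Rightarrow> nat \<Rightarrow> 'a) \<Rightarrow> complex \<Rightarrow> bool"
  where
  "condition_H D A L e z \<longleftrightarrow>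
     (\<forall>p\<in>{0, 1}. \<forall>q\<in>{0, 1}. \<forall>u\<in>D. A u = z *\<^sub>C u \<longrightarrow>
       (\<lambda>n. norm ((\<Sum>j<n. cinner ((A ^^ p) (orth_proj (L n) u)) ((A ^^ q) (e n j)) *\<^sub>C e n j)
                  - z ^ (p + q) *\<^sub>C u)) \<longlonglongrightarrow> 0)"

definition mat_A0 :: "('a::complex_hilbert \<Rightarrow> 'a) \<Rightarrow> (nat \<Rightarrow> nat \<Rightarrow> 'a) \<Rightarrow> nat \<Rightarrow> complex mat" where
  "mat_A0 A e n = Matrix.mat n n (\<lambda>(j, k). cinner (A (e n j)) (A (e n k)))"

definition mat_A1 :: "('a::complex_hilbert \<Rightarrow> 'a) \<Rightarrow> (nat \<Rightarrow> nat \<Rightarrow> 'a) \<Rightarrow> nat \<Rightarrow> complex mat" where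
  "mat_A1 A e n = Matrix.mat n n (\<lambda>(j, k). cinner (A (e n j)) (e n k))"

definition mat_A2 :: "(nat \<Rightarrow> nat \<Rightarrow> 'a::complex_hilbert) \<Rightarrow> nat \<Rightarrow> complex mat" where
  "mat_A2 e n = Matrix.mat n n (\<lambda>(j, k). cinner (e n j) (e n k))"

definition euclidean_norm :: "complex Matrix.vec \<Rightarrow> real" where
  "euclidean_norm v = L2_set (\<lambda>i. cmod (vec_index v i)) {..<dim_vec v}"

definition mat_norm :: "complex mat \<Rightarrow> real" where
  "mat_norm M = (SUP v \<in> {v \<in> carrier_vec (dim_col M). euclidean_norm v \<le> 1}.
     euclidean_norm (mult_mat_vec M v))"

definition pencil_det :: "complex mat \<Rightarrow> complex mat \<Rightarrow> complex mat \<Rightarrow> complex \<Rightarrow> complex" where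
  "pencil_det M0 M1 M2 z = Determinant.det (M0 - (2 * z) \<cdot>\<^sub>m M1 + z\<^sup>2 \<cdot>\<^sub>m M2)"

end

theory Submission
  imports Defs "HOL-Complex_Analysis.Conformal_Mappings"
begin

text \<open>Put \<open>B = A - l\<close> and \<open>E = ker B\<close>. By the spectral gap, \<open>d * norm q \<le> norm (B q)\<close> for \<open>q \<in> D\<close>
  orthogonal to \<open>E\<close>. With \<open>s = z - l\<close>, the pencil matrix at \<open>z\<close> represents the form
  \<open>b w x = \<langle>B w, B x\<rangle> - 2 s \<langle>B w, x\<rangle> + s\<^sup>2 \<langle>w, x\<rangle>\<close> on the trial space. This form is coercive on the
  complement of \<open>E\<close> as long as \<open>cmod s \<le> d / 4\<close> and equals \<open>s\<^sup>2\<close> times the inner product on \<open>E\<close>,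
  which condition (H) approximates by the trial spaces so well that the two parts decouple. Hence the
  pencil is bounded below on the annulus, uniformly in \<open>n\<close> and stably under small perturbations, which
  excludes zeros of the determinant there. At \<open>z = l\<close> the projection of an eigenvector is almost null;
  by the maximum modulus principle for the inverse of the pencil, this forces a zero in the disk.\<close>

text \<open>The form \<open>b\<close> is neither Hermitian nor coercive as a whole: on
  \<open>E\<close> it is \<open>s\<^sup>2\<close> times the inner product, and
  \<open>s\<^sup>2\<close> may have any argument. Condition (H) does not mention the norm of
  \<open>B\<close> applied to a projected eigenvector \<open>P u\<close>. It controls only the
  functional sending \<open>w\<close> to the inner product of \<open>B (P u)\<close> and
  \<open>B w\<close> on the trial space. Taking \<open>w = P u\<close> recovers the norm at the
  price of a square root; for this reason the functional is made smaller than
  \<open>\<rho>\<^sup>2\<close>, while the other errors are allowed to be of size \<rho>. Trial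
  spaces for different \<open>n\<close> are unrelated, so every estimate is made at a fixed
  \<open>n\<close>, with constants depending on \<delta>, \<open>d\<close> and \<open>l\<close>
  alone. This is what allows perturbation bounds that do not shrink as \<open>n\<close> grows. The
  gap inequality is extracted from the resolvent set itself, by way of the quadratic form of
  \<open>B\<close>, without a spectral decomposition.\<close>

subsection \<open>Inner product\<close>

lemma cinner_add_right: "cinner x (y + z) = cinner x y + cinner x z"
  by (metis cinner_commute cinner_add_left complex_cnj_add)

lemma cinner_scaleC_right: "cinner x (c *\<^sub>C y) = cnj c * cinner x y"
  by (metis cinner_commute cinner_scaleC_left complex_cnj_mult)

lemma cinner_zero_left [simp]: "cinner 0 x = 0"
  using cinner_scaleC_left[of 0 0 x] by simp

lemma cinner_zero_right [simp]: "cinner x 0 = 0"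
  using cinner_scaleC_right[of x 0 0] by simp

lemma cinner_minus_left: "cinner (- x) y = - cinner x y"
  using cinner_add_left[of x "- x" y] by (simp add: eq_neg_iff_add_eq_0 add.commute)

lemma cinner_minus_right: "cinner x (- y) = - cinner x y"
  using cinner_add_right[of x y "- y"] by (simp add: eq_neg_iff_add_eq_0 add.commute)

lemma cinner_diff_left: "cinner (x - y) z = cinner x z - cinner y z"
  using cinner_add_left[of x "- y" z] by (simp add: cinner_minus_left)

lemma cinner_diff_right: "cinner x (y - z) = cinner x y - cinner x z"
  using cinner_add_right[of x y "- z"] by (simp add: cinner_minus_right)

lemma cinner_sum_left: "cinner (\<Sum>i\<in>I. f i) y = (\<Sum>i\<in>I. cinner (f i) y)"
  by (induction I rule: infinite_finite_induct) (simp_all add: cinner_add_left)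

lemma cinner_sum_right: "cinner x (\<Sum>i\<in>I. f i) = (\<Sum>i\<in>I. cinner x (f i))"
  by (induction I rule: infinite_finite_induct) (simp_all add: cinner_add_right)

lemmas cinner_simps = cinner_add_left cinner_add_right cinner_diff_left cinner_diff_right
  cinner_scaleC_left cinner_scaleC_right

lemma norm_scaleC: "norm (c *\<^sub>C x) = cmod c * norm (x :: 'a::complex_hilbert)"
proof -
  have "complex_of_real ((norm (c *\<^sub>C x))\<^sup>2) = complex_of_real ((cmod c * norm x)\<^sup>2)"
    unfolding cinner_self[symmetric] cinner_scaleC_left cinner_scaleC_right
    by (simp only: cinner_self power_mult_distrib of_real_mult complex_norm_square[of c] mult_ac)
  then have "(norm (c *\<^sub>C x))\<^sup>2 = (cmod c * norm x)\<^sup>2"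
    using of_real_eq_iff by blast
  then show ?thesis
    by (simp add: power2_eq_iff_nonneg)
qed

text \<open>Cauchy-Schwarz: \<open>t *\<^sub>C x - c *\<^sub>C y\<close> is a multiple of the part
  of \<open>x\<close> orthogonal to \<open>y\<close>, and its squared norm is nonnegative. Scaling
  \<open>x\<close> by \<open>t\<close> avoids dividing by the norm of \<open>y\<close>.\<close>

lemma norm_cinner_le: "cmod (cinner x y) \<le> norm x * norm (y :: 'a::complex_hilbert)"
proof (cases "y = 0")
  case False
  define c where "c = cinner x y"
  define t where "t = complex_of_real ((norm y)\<^sup>2)"
  have "t \<noteq> 0" using False by (simp add: t_def)
  have "cinner y x = cnj c" unfolding c_def by (rule cinner_commute)
  then have "cinner (t *\<^sub>C x - c *\<^sub>C y) (t *\<^sub>C x - c *\<^sub>C y)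
      = t * (t * complex_of_real ((norm x)\<^sup>2) - c * cnj c)"
    unfolding cinner_simps
    by (simp only: c_def[symmetric] cinner_self t_def[symmetric])
      (simp add: t_def algebra_simps)
  also have "\<dots> = complex_of_real ((norm y)\<^sup>2 * ((norm y)\<^sup>2 * (norm x)\<^sup>2 - (cmod c)\<^sup>2))"
    by (simp only: t_def of_real_mult of_real_diff complex_norm_square[of c])
  finally have "(norm (t *\<^sub>C x - c *\<^sub>C y))\<^sup>2 = (norm y)\<^sup>2 * ((norm y)\<^sup>2 * (norm x)\<^sup>2 - (cmod c)\<^sup>2)"
    unfolding cinner_self using of_real_eq_iff by blast
  then have "0 \<le> (norm y)\<^sup>2 * ((norm y)\<^sup>2 * (norm x)\<^sup>2 - (cmod c)\<^sup>2)"
    by (metis zero_le_power2)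
  then have "(cmod c)\<^sup>2 \<le> (norm x * norm y)\<^sup>2"
    using False by (simp add: zero_le_mult_iff power_mult_distrib mult.commute)
  then show ?thesis
    unfolding c_def by (rule power2_le_imp_le) simp
qed simp

lemma Re_cinner_self: "Re (cinner x x) = (norm x)\<^sup>2"
  by (simp add: cinner_self)

lemma norm_add_sq: "(norm (x + y))\<^sup>2 = (norm x)\<^sup>2 + 2 * Re (cinner x y) + (norm (y::'a::complex_hilbert))\<^sup>2"
proof -
  have "Re (cinner y x) = Re (cinner x y)"
    by (simp add: cinner_commute[of y x])
  then show ?thesis
    unfolding Re_cinner_self[symmetric] by (simp add: cinner_simps)
qed

lemma norm_diff_sq: "(norm (x - y))\<^sup>2 = (norm x)\<^sup>2 - 2 * Re (cinner x y) + (norm (y::'a::complex_hilbert))\<^sup>2"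
  using norm_add_sq[of x "- y"] by (simp add: cinner_minus_right)

lemma tendsto_cinner_right:
  assumes "(f \<longlongrightarrow> y) F"
  shows "((\<lambda>i. cinner x (f i)) \<longlongrightarrow> cinner x (y::'a::complex_hilbert)) F"
proof -
  have "((\<lambda>i. norm x * norm (f i - y)) \<longlongrightarrow> norm x * norm (y - y)) F"
    by (intro tendsto_intros assms)
  then have "((\<lambda>i. norm x * norm (f i - y)) \<longlongrightarrow> 0) F" by simp
  then have "((\<lambda>i. cinner x (f i) - cinner x y) \<longlongrightarrow> 0) F"
    by (rule Lim_null_comparison[rotated])
      (simp add: norm_cinner_le flip: cinner_diff_right)
  then show ?thesis
    using Lim_null by blast
qed

subsection \<open>Spectral gaps of self-adjoint operators\<close>

lemma linear_operatorD:
  assumes "linear_operator D A"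
  shows linear_operator_zero: "0 \<in> D"
    and linear_operator_add: "u \<in> D \<Longrightarrow> v \<in> D \<Longrightarrow> u + v \<in> D"
    and linear_operator_scale: "u \<in> D \<Longrightarrow> c *\<^sub>C u \<in> D"
    and linear_operator_diff: "u \<in> D \<Longrightarrow> v \<in> D \<Longrightarrow> u - v \<in> D"
    and linear_operator_app_add: "u \<in> D \<Longrightarrow> v \<in> D \<Longrightarrow> A (u + v) = A u + A v"
    and linear_operator_app_scale: "u \<in> D \<Longrightarrow> A (c *\<^sub>C u) = c *\<^sub>C A u"
    and linear_operator_app_diff: "u \<in> D \<Longrightarrow> v \<in> D \<Longrightarrow> A (u - v) = A u - A v"
    and linear_operator_app_zero: "A 0 = 0"
proof -
  have s: "csubspace D" using assms by (simp add: linear_operator_def)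
  show "0 \<in> D" "u \<in> D \<Longrightarrow> v \<in> D \<Longrightarrow> u + v \<in> D" "u \<in> D \<Longrightarrow> c *\<^sub>C u \<in> D"
    "u \<in> D \<Longrightarrow> v \<in> D \<Longrightarrow> u - v \<in> D"
    using s complex_vector.subspace_0 complex_vector.subspace_add complex_vector.subspace_scale
      complex_vector.subspace_diff by blast+
  show add: "u \<in> D \<Longrightarrow> v \<in> D \<Longrightarrow> A (u + v) = A u + A v" for u v
    using assms by (simp add: linear_operator_def)
  show "u \<in> D \<Longrightarrow> A (c *\<^sub>C u) = c *\<^sub>C A u"
    using assms by (simp add: linear_operator_def)
  show "u \<in> D \<Longrightarrow> v \<in> D \<Longrightarrow> A (u - v) = A u - A v"
    using add[of "u - v" v] complex_vector.subspace_diff[OF s] by simp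
  show "A 0 = 0"
    using add[of 0 0] complex_vector.subspace_0[OF s] by simp
qed

lemma linear_operator_sum:
  assumes "linear_operator D A" "\<And>i. i \<in> I \<Longrightarrow> f i \<in> D"
  shows "(\<Sum>i\<in>I. f i) \<in> D" "A (\<Sum>i\<in>I. f i) = (\<Sum>i\<in>I. A (f i))"
  using assms(2)
  by (induction I rule: infinite_finite_induct)
    (simp_all add: linear_operatorD[OF assms(1)])

lemma self_adjoint_symmetric:
  assumes "self_adjoint D A" "u \<in> D" "v \<in> D"
  shows "cinner (A u) v = cinner u (A v)"
proof -
  have "(v, A v) \<in> adjoint_graph D A"
    using assms by (auto simp: self_adjoint_def operator_graph_def)
  then show ?thesis using assms by (auto simp: adjoint_graph_def)
qed

lemma self_adjoint_linear: "self_adjoint D A \<Longrightarrow> linear_operator D A"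
  by (simp add: self_adjoint_def)

text \<open>Each condition defining the adjoint graph survives limits, and self-adjointness reads
  the limit pair as a point of the operator graph again.\<close>

lemma self_adjoint_closed:
  assumes "self_adjoint D A" "\<And>i. f i \<in> D" "f \<longlonglongrightarrow> v" "(\<lambda>i. A (f i)) \<longlonglongrightarrow> w"
  shows "v \<in> D" "A v = w"
proof -
  have "cinner (A u) v = cinner u w" if "u \<in> D" for u
  proof (rule LIMSEQ_unique)
    show "(\<lambda>i. cinner (A u) (f i)) \<longlonglongrightarrow> cinner (A u) v"
      by (rule tendsto_cinner_right[OF assms(3)])
    show "(\<lambda>i. cinner (A u) (f i)) \<longlonglongrightarrow> cinner u w"
      using tendsto_cinner_right[OF assms(4), of u] self_adjoint_symmetric[OF assms(1) that assms(2)]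
      by simp
  qed
  then have "(v, w) \<in> operator_graph D A"
    using assms(1) by (auto simp: self_adjoint_def adjoint_graph_def)
  then show "v \<in> D" "A v = w"
    by (auto simp: operator_graph_def)
qed

lemma self_adjoint_shift:
  assumes "self_adjoint D A"
  shows "self_adjoint D (\<lambda>u. A u - complex_of_real c *\<^sub>C u)"
proof -
  let ?B = "\<lambda>u. A u - complex_of_real c *\<^sub>C u"
  note lin = self_adjoint_linear[OF assms]
  have "linear_operator D ?B"
    using lin by (simp add: linear_operator_def scaleC_add_right complex_vector.scale_right_diff_distrib
        scaleC_scaleC mult.commute)
  moreover have "operator_graph D ?B = adjoint_graph D ?B"
  proof -
    have "(v, w) \<in> adjoint_graph D ?B \<longleftrightarrow> (v, w + complex_of_real c *\<^sub>C v) \<in> adjoint_graph D A" for v w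
      by (auto simp: adjoint_graph_def cinner_simps algebra_simps)
    also have "\<dots> v w \<longleftrightarrow> (v, w) \<in> operator_graph D ?B" for v w
    proof -
      have "adjoint_graph D A = operator_graph D A"
        using assms by (simp add: self_adjoint_def)
      then show ?thesis by (auto simp: operator_graph_def eq_diff_eq)
    qed
    finally show ?thesis by auto
  qed
  ultimately show ?thesis
    using assms by (simp add: self_adjoint_def)
qed

lemma self_adjoint_shift_real:
  assumes "self_adjoint D A" "cnj c = c"
  shows "self_adjoint D (\<lambda>u. A u - c *\<^sub>C u)"
proof -
  have "complex_of_real (Re c) = c" using assms(2) by (simp add: complex_eq_iff)
  then show ?thesis using self_adjoint_shift[OF assms(1), of "Re c"] by simp
qed

lemma resolvent_set_shift:
  "z \<in> resolvent_set D (\<lambda>u. A u - c *\<^sub>C u) \<longleftrightarrow> z + c \<in> resolvent_set D A"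
  by (simp add: resolvent_set_def scaleC_add_left algebra_simps)

text \<open>With \<open>m\<close> the infimum of \<open>norm (B u)\<close> over unit vectors and \<open>B v = u\<close> for an almost minimising
  \<open>u\<close>, the vector \<open>(B - m) (B + m) v = B u - m\<^sup>2 v\<close> is small, so one of \<open>\<plusminus>m\<close> is in the spectrum.\<close>

lemma bounded_below_if_resolvent_interval:
  assumes sa: "self_adjoint D B"
    and res: "\<And>t. \<bar>t\<bar> < r \<Longrightarrow> complex_of_real t \<in> resolvent_set D B"
    and x: "x \<in> D"
  shows "r * norm x \<le> norm (B x)"
\<comment> \<open>For nonpositive \<open>r\<close>, or if \<open>D\<close> contains only 0, the
  bound is trivial; otherwise the infimum below is over a nonempty set and 0 belongs to the
  interval.\<close>
proof (cases "r > 0 \<and> (\<exists>x\<in>D. x \<noteq> 0)")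
  case False
  then have "r * norm x \<le> 0"
    using x by (cases "x = 0") (auto intro: mult_nonpos_nonneg)
  then show ?thesis by (rule order_trans) simp
next
  case True
  note lin = self_adjoint_linear[OF sa]
  define S where "S = {norm (B u) | u. u \<in> D \<and> norm u = 1}"
  define m where "m = Inf S"
  have norm1: "\<exists>u\<in>D. norm u = 1 \<and> norm (B x) = norm x * norm (B u)" if "x \<in> D" "x \<noteq> 0" for x
    using that linear_operator_scale[OF lin] linear_operator_app_scale[OF lin]
    by (intro bexI[of _ "complex_of_real (1 / norm x) *\<^sub>C x"]) (auto simp: norm_scaleC norm_divide)
  have S_ne: "S \<noteq> {}" using norm1 True unfolding S_def by blast
  have S_bdd: "bdd_below S" unfolding S_def by (rule bdd_belowI[of _ 0]) auto
  have bb: "\<exists>k>0. \<forall>u\<in>D. k * norm u \<le> norm (B u - complex_of_real t *\<^sub>C u)" if t: "\<bar>t\<bar> < r" for t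
  proof -
    obtain C where C: "\<forall>u\<in>D. norm u \<le> C * norm (B u - complex_of_real t *\<^sub>C u)"
      using res[OF t] by (auto simp: resolvent_set_def)
    have "norm u / (\<bar>C\<bar> + 1) \<le> norm (B u - complex_of_real t *\<^sub>C u)" if "u \<in> D" for u
    proof -
      have "norm u \<le> C * norm (B u - complex_of_real t *\<^sub>C u)" using C that by blast
      also have "\<dots> \<le> (\<bar>C\<bar> + 1) * norm (B u - complex_of_real t *\<^sub>C u)"
        by (rule mult_right_mono) auto
      finally show ?thesis by (simp add: divide_simps mult.commute)
    qed
    then show ?thesis
      by (intro exI[of _ "1 / (\<bar>C\<bar> + 1)"]) (simp add: add_nonneg_pos)
  qed
  have lower: "m * norm x \<le> norm (B x)" if "x \<in> D" for x
  proof (cases "x = 0")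
    case False
    obtain u where u: "u \<in> D" "norm u = 1" "norm (B x) = norm x * norm (B u)"
      using norm1[OF \<open>x \<in> D\<close> False] by blast
    have "m \<le> norm (B u)"
      unfolding m_def using u by (intro cInf_lower S_bdd) (auto simp: S_def)
    then show ?thesis
      using u(3) by (metis mult.commute mult_left_mono norm_ge_zero)
  qed simp
  have "m > 0"
  proof -
    obtain k where "k > 0" "\<forall>u\<in>D. k * norm u \<le> norm (B u - complex_of_real 0 *\<^sub>C u)"
      using bb[of 0] True by auto
    then have "k \<le> m"
      unfolding m_def by (intro cInf_greatest S_ne) (fastforce simp: S_def)
    then show ?thesis using \<open>k > 0\<close> by simp
  qed
  have "r \<le> m"
  proof (rule ccontr)
    assume "\<not> r \<le> m"
    then have m: "\<bar>m\<bar> < r" "\<bar>- m\<bar> < r" using \<open>m > 0\<close> by auto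
    obtain k1 where k1: "k1 > 0" "\<And>u. u \<in> D \<Longrightarrow> k1 * norm u \<le> norm (B u - complex_of_real m *\<^sub>C u)"
      using bb[OF m(1)] by blast
    obtain k2 where k2: "k2 > 0" "\<And>u. u \<in> D \<Longrightarrow> k2 * norm u \<le> norm (B u + complex_of_real m *\<^sub>C u)"
      using bb[OF m(2)] by auto
    \<comment> \<open>Applying the bounds at \<open>- m\<close> and \<open>m\<close> in turn to a
      vector of norm at least \<open>1 / (m + 1)\<close> gives \<gamma> as a lower bound for
      \<open>(B - m) (B + m) v\<close>.\<close>
    define \<gamma> where "\<gamma> = k1 * k2 / (m + 1)"
    have "\<gamma> > 0" using k1 k2 \<open>m > 0\<close> by (simp add: \<gamma>_def)
    \<comment> \<open>The squared norm of the same vector will be at most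
      \<open>\<eta> * (2 * m + \<eta>)\<close>. The cap 1 replaces the second factor by
      \<open>2 * m + 1\<close>, and the 2 in the denominator makes the comparison with
      \<open>\<gamma>\<^sup>2\<close> strict.\<close>
    define \<eta> where "\<eta> = min 1 (\<gamma>\<^sup>2 / (2 * (2 * m + 1)))"
    have "\<eta> > 0" using \<open>\<gamma> > 0\<close> \<open>m > 0\<close> by (simp add: \<eta>_def)
    obtain u where u: "u \<in> D" "norm u = 1" "norm (B u) < m + \<eta>"
      using cInf_less_iff[OF S_ne S_bdd, of "m + \<eta>"] \<open>\<eta> > 0\<close> by (auto simp: S_def m_def)
    have "u \<in> (\<lambda>u. B u - complex_of_real 0 *\<^sub>C u) ` D"
      using res[of 0] True by (auto simp: resolvent_set_def bij_betw_def)
    then obtain v where v: "v \<in> D" "B v = u" by auto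
    define w where "w = B v + complex_of_real m *\<^sub>C v"
    have wD: "w \<in> D" using u v by (auto simp: w_def intro: linear_operatorD[OF lin])
    have w: "B w - complex_of_real m *\<^sub>C w = B u - complex_of_real (m\<^sup>2) *\<^sub>C v"
      using u v by (simp add: w_def linear_operatorD[OF lin] scaleC_add_right scaleC_scaleC
          power2_eq_square)
    have "cinner (B u) v = 1"
      using self_adjoint_symmetric[OF sa u(1) v(1)] v u by (simp add: cinner_self)
    then have "1 \<le> norm (B u) * norm v" using norm_cinner_le[of "B u" v] by simp
    also have "\<dots> \<le> (m + 1) * norm v"
      using u(3) by (intro mult_right_mono) (auto simp: \<eta>_def)
    finally have v_lower: "1 / (m + 1) \<le> norm v" using \<open>m > 0\<close> by (simp add: divide_simps mult.commute)
    have "m * norm v \<le> 1" using lower[OF v(1)] v u by simp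
    then have "(m * norm v)\<^sup>2 \<le> 1" using \<open>m > 0\<close> by (simp add: power_le_one)
    have "(norm (B u - complex_of_real (m\<^sup>2) *\<^sub>C v))\<^sup>2
        = (norm (B u))\<^sup>2 - 2 * m\<^sup>2 + m\<^sup>2 * (m * norm v)\<^sup>2"
      unfolding norm_diff_sq using \<open>cinner (B u) v = 1\<close>
      by (simp add: cinner_simps norm_scaleC power_mult_distrib power2_eq_square flip: of_real_mult)
    also have "\<dots> \<le> (norm (B u))\<^sup>2 - 2 * m\<^sup>2 + m\<^sup>2 * 1"
      using \<open>(m * norm v)\<^sup>2 \<le> 1\<close> by (intro add_left_mono mult_left_mono) auto
    also have "\<dots> \<le> (m + \<eta>)\<^sup>2 - m\<^sup>2"
      using power_mono[of "norm (B u)" "m + \<eta>" 2] u(3) by simp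
    also have "\<dots> = \<eta> * (2 * m + \<eta>)" by (simp add: power2_eq_square algebra_simps)
    also have "\<dots> \<le> \<eta> * (2 * m + 1)"
      using \<open>\<eta> > 0\<close> by (intro mult_left_mono) (auto simp: \<eta>_def)
    also have "\<dots> \<le> \<gamma>\<^sup>2 / (2 * (2 * m + 1)) * (2 * m + 1)"
      using \<open>m > 0\<close> by (intro mult_right_mono) (auto simp: \<eta>_def)
    also have "\<dots> < \<gamma>\<^sup>2" using \<open>m > 0\<close> \<open>\<gamma> > 0\<close> by (simp add: divide_simps)
    finally have "norm (B u - complex_of_real (m\<^sup>2) *\<^sub>C v) < \<gamma>"
      using \<open>\<gamma> > 0\<close> power2_less_imp_less by fastforce
    moreover have "\<gamma> \<le> norm (B u - complex_of_real (m\<^sup>2) *\<^sub>C v)"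
    proof -
      have "\<gamma> = k1 * (k2 * (1 / (m + 1)))" by (simp add: \<gamma>_def)
      also have "\<dots> \<le> k1 * (k2 * norm v)"
        using v_lower k1 k2 by (intro mult_left_mono) auto
      also have "\<dots> \<le> k1 * norm w"
        using k2(2)[OF v(1)] k1 by (intro mult_left_mono) (auto simp: w_def)
      also have "\<dots> \<le> norm (B w - complex_of_real m *\<^sub>C w)" by (rule k1(2)[OF wD])
      finally show ?thesis by (simp add: w)
    qed
    ultimately show False by simp
  qed
  then have "r * norm x \<le> m * norm x" by (intro mult_right_mono) auto
  also have "\<dots> \<le> norm (B x)" by (rule lower[OF x])
  finally show ?thesis .
qed

text \<open>The inequality is proved on vectors \<open>B y\<close> with \<open>B y\<close> in
  \<open>D\<close>. A general \<open>q\<close> is approximated by \<open>B (r n)\<close>, where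
  \<open>r n\<close> solves \<open>(B - ts n) (r n) = q\<close> and \<open>ts n\<close> tends to 0.
  The defect \<open>k n = - ts n * r n\<close> converges to a vector of the kernel, and
  \<open>q\<close> is orthogonal to that limit.\<close>

lemma spectral_gap:
  assumes sa: "self_adjoint D B" and d: "d > 0"
    and res: "\<And>t. 0 < \<bar>t\<bar> \<Longrightarrow> \<bar>t\<bar> < d \<Longrightarrow> complex_of_real t \<in> resolvent_set D B"
    and q: "q \<in> D" and orth: "\<And>k. k \<in> eigenspace D B 0 \<Longrightarrow> cinner q k = 0"
  shows "d * norm q \<le> norm (B q)"
proof -
  note lin = self_adjoint_linear[OF sa]
  note lins = linear_operatorD[OF lin]
  \<comment> \<open>The points \<open>d / 2\<close> and \<open>- d / 2\<close> are centres of
    intervals of length \<open>d\<close> free of spectrum. Squaring the resulting bound cancels the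
    term in the norm of \<open>x\<close> and leaves an inequality for the quadratic form.\<close>
  have half: "2 * c * Re (cinner (B x) x) \<le> (norm (B x))\<^sup>2" if x: "x \<in> D" and c: "\<bar>c\<bar> = d / 2" for x c
  proof -
    have "\<bar>c\<bar> * norm x \<le> norm (B x - complex_of_real c *\<^sub>C x)"
    proof (rule bounded_below_if_resolvent_interval[OF self_adjoint_shift[OF sa] _ x])
      fix t assume "\<bar>t\<bar> < \<bar>c\<bar>"
      then have "0 < \<bar>t + c\<bar>" "\<bar>t + c\<bar> < d" using c by auto
      from res[OF this] show "complex_of_real t \<in> resolvent_set D (\<lambda>u. B u - complex_of_real c *\<^sub>C u)"
        by (simp add: resolvent_set_shift)
    qed
    then have "(\<bar>c\<bar> * norm x)\<^sup>2 \<le> (norm (B x - complex_of_real c *\<^sub>C x))\<^sup>2"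
      by (intro power_mono) auto
    then show ?thesis
      unfolding norm_diff_sq by (simp add: cinner_simps norm_scaleC power_mult_distrib)
  qed
  have form: "d * \<bar>Re (cinner (B x) x)\<bar> \<le> (norm (B x))\<^sup>2" if "x \<in> D" for x
    using half[OF that, of "d / 2"] half[OF that, of "- (d / 2)"] d by (auto simp: abs_if)
  have below: "t * norm x \<le> norm (B x - complex_of_real t *\<^sub>C x)"
    if "x \<in> D" "0 < t" "t \<le> d / 2" for x t
  proof -
    have "2 * t * Re (cinner (B x) x) \<le> 2 * t * \<bar>Re (cinner (B x) x)\<bar>"
      using that by (intro mult_left_mono) auto
    also have "\<dots> \<le> d * \<bar>Re (cinner (B x) x)\<bar>"
      using that by (intro mult_right_mono) auto
    also have "\<dots> \<le> (norm (B x))\<^sup>2" by (rule form[OF that(1)])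
    finally have "(t * norm x)\<^sup>2 \<le> (norm (B x - complex_of_real t *\<^sub>C x))\<^sup>2"
      unfolding norm_diff_sq by (simp add: cinner_simps norm_scaleC power_mult_distrib)
    then show ?thesis by (rule power2_le_imp_le) simp
  qed
  \<comment> \<open>\<open>x\<^sup>4 - d\<^sup>2 x\<^sup>2\<close> is half of \<open>(x\<^sup>2 - d x) (x + d)\<^sup>2 + (x\<^sup>2 + d x) (x - d)\<^sup>2\<close>.\<close>
  have range: "d * norm (B y) \<le> norm (B (B y))" if y: "y \<in> D" "B y \<in> D" for y
  proof -
    define a \<beta> where "a = Re (cinner (B (B y)) (B y))" and "\<beta> = Re (cinner (B y) y)"
    have aux: "cinner (B (B y)) y = cinner (B y) (B y)"
      by (rule self_adjoint_symmetric[OF sa y(2) y(1)])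
    have *: "(norm (B (B y + complex_of_real c *\<^sub>C y)))\<^sup>2
        = (norm (B (B y)))\<^sup>2 + 2 * c * a + c\<^sup>2 * (norm (B y))\<^sup>2"
      "Re (cinner (B (B y + complex_of_real c *\<^sub>C y)) (B y + complex_of_real c *\<^sub>C y))
        = a + 2 * c * (norm (B y))\<^sup>2 + c\<^sup>2 * \<beta>" for c
    proof -
      have Bx: "B (B y + complex_of_real c *\<^sub>C y) = B (B y) + complex_of_real c *\<^sub>C B y"
        using y by (simp add: lins)
      show "(norm (B (B y + complex_of_real c *\<^sub>C y)))\<^sup>2
          = (norm (B (B y)))\<^sup>2 + 2 * c * a + c\<^sup>2 * (norm (B y))\<^sup>2"
        unfolding Bx norm_add_sq
        by (simp add: cinner_scaleC_right norm_scaleC power_mult_distrib a_def)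
      show "Re (cinner (B (B y + complex_of_real c *\<^sub>C y)) (B y + complex_of_real c *\<^sub>C y))
          = a + 2 * c * (norm (B y))\<^sup>2 + c\<^sup>2 * \<beta>"
        unfolding Bx by (simp add: cinner_add_left cinner_add_right cinner_scaleC_left
            cinner_scaleC_right aux cinner_self a_def \<beta>_def power2_eq_square algebra_simps)
    qed
    have mem: "B y + complex_of_real c *\<^sub>C y \<in> D" for c
      using y by (simp add: lins)
    have "d * (a + 2 * d * (norm (B y))\<^sup>2 + d\<^sup>2 * \<beta>) \<le> (norm (B (B y)))\<^sup>2 + 2 * d * a + d\<^sup>2 * (norm (B y))\<^sup>2"
      using order_trans[OF mult_left_mono[OF abs_ge_self] form[OF mem[of d]]] d by (simp add: *)
    moreover have "- d * (a - 2 * d * (norm (B y))\<^sup>2 + d\<^sup>2 * \<beta>)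
        \<le> (norm (B (B y)))\<^sup>2 - 2 * d * a + d\<^sup>2 * (norm (B y))\<^sup>2"
      using order_trans[OF mult_left_mono[OF abs_ge_minus_self] form[OF mem[of "- d"]]] d
      by (simp add: *(1)[of "- d", simplified] *(2)[of "- d", simplified] algebra_simps)
    ultimately have "(d * norm (B y))\<^sup>2 \<le> (norm (B (B y)))\<^sup>2"
      by (simp add: algebra_simps power2_eq_square)
    then show ?thesis by (rule power2_le_imp_le) simp
  qed
  define ts where "ts n = d / 2 * (1 / real (Suc n))" for n
  have ts: "0 < ts n" "ts n \<le> d / 2" "ts n < d" for n
  proof -
    have "ts n \<le> d / 2 * 1" unfolding ts_def using d by (intro mult_left_mono) auto
    then show "ts n \<le> d / 2" by simp
    then show "ts n < d" using d by simp
    show "0 < ts n" using d by (simp add: ts_def)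
  qed
  have ts_lim: "ts \<longlonglongrightarrow> 0"
    unfolding ts_def using tendsto_mult_right_zero[OF LIMSEQ_inverse_real_of_nat, of "d / 2"]
    by (simp add: inverse_eq_divide)
  have solve: "\<exists>u\<in>D. B u - complex_of_real (ts n) *\<^sub>C u = v" for n v
  proof -
    have "complex_of_real (ts n) \<in> resolvent_set D B" using ts[of n] by (intro res) auto
    then have "v \<in> (\<lambda>u. B u - complex_of_real (ts n) *\<^sub>C u) ` D"
      by (simp add: resolvent_set_def bij_betw_def)
    then show ?thesis by auto
  qed
  obtain r where r: "\<And>n. r n \<in> D" "\<And>n. B (r n) - complex_of_real (ts n) *\<^sub>C r n = q"
    using solve[of _ q] by metis
  have Br: "B (r n) = q + complex_of_real (ts n) *\<^sub>C r n" for n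
    using r(2)[of n] by (simp add: diff_eq_eq)
  have tr: "ts n * norm (r n) \<le> norm q" for n
    using below[OF r(1) ts(1,2), of n n] r(2) by simp
  have nBr: "norm (B (r n)) \<le> 2 * norm q" for n
  proof -
    have "norm (B (r n)) \<le> norm q + norm (complex_of_real (ts n) *\<^sub>C r n)"
      unfolding Br by (rule norm_triangle_ineq)
    then show ?thesis using tr[of n] ts(1)[of n] by (simp add: norm_scaleC)
  qed
  define k where "k n = q - B (r n)" for n
  have k: "k n = - (complex_of_real (ts n) *\<^sub>C r n)" for n by (simp add: k_def Br)
  \<comment> \<open>By the resolvent identity \<open>r n - r m\<close> is \<open>ts n - ts m\<close>
    times a vector \<open>y\<close>, which need not stay bounded as the shifts tend to 0. Only
    \<open>B y\<close> enters, and the estimate on the range bounds it uniformly: the term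
    \<open>ts n * norm (B y)\<close> is absorbed because \<open>ts n\<close> is at most
    \<open>d / 2\<close>.\<close>
  have lip: "norm (k n - k m) \<le> \<bar>ts n - ts m\<bar> * (4 * norm q / d)" for n m
  proof -
    obtain y where y: "y \<in> D" "B y - complex_of_real (ts n) *\<^sub>C y = r m" using solve by blast
    define c where "c = complex_of_real (ts n - ts m)"
    define z where "z = r n - r m - c *\<^sub>C y"
    have zD: "z \<in> D" by (simp add: z_def lins r y)
    have By: "B y = r m + complex_of_real (ts n) *\<^sub>C y" using y(2) by (simp add: diff_eq_eq)
    have "B z - complex_of_real (ts n) *\<^sub>C z = 0"
      by (simp add: z_def lins r y Br By c_def scaleC_add_right complex_vector.scale_right_diff_distrib
          complex_vector.scale_left_diff_distrib scaleC_scaleC algebra_simps)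
    then have "z = 0" using below[OF zD ts(1,2), of n] ts(1)[of n] by (simp add: mult_le_0_iff)
    then have "r n - r m = c *\<^sub>C y" by (simp add: z_def)
    then have "B (r n) - B (r m) = c *\<^sub>C B y"
      using lins(7)[OF r(1) r(1), of n m] lins(6)[OF y(1), of c] by simp
    then have "norm (k n - k m) = \<bar>ts n - ts m\<bar> * norm (B y)"
      unfolding k_def c_def using norm_minus_commute[of "B (r n)" "B (r m)"]
      by (simp add: norm_scaleC del: of_real_diff)
    also have "norm (B y) \<le> 4 * norm q / d"
    proof -
      have ByD: "B y \<in> D" by (simp add: By lins r y)
      have "d * norm (B y) \<le> norm (B (B y))" by (rule range[OF y(1) ByD])
      also have "B (B y) = B (r m) + complex_of_real (ts n) *\<^sub>C B y"
        by (subst By) (simp add: lins r y)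
      also have "norm \<dots> \<le> norm (B (r m)) + ts n * norm (B y)"
        using norm_triangle_ineq[of "B (r m)" "complex_of_real (ts n) *\<^sub>C B y"] ts(1)[of n]
        by (simp add: norm_scaleC)
      also have "\<dots> \<le> 2 * norm q + d / 2 * norm (B y)"
        by (intro add_mono nBr mult_right_mono ts) auto
      finally show ?thesis using d by (simp add: field_simps)
    qed
    finally show ?thesis by (simp add: mult_left_mono)
  qed
  have "Cauchy k"
  proof (rule metric_CauchyI)
    fix e :: real assume "e > 0"
    define M where "M = 4 * norm q / d + 1"
    have "M > 0" using d by (simp add: M_def add_nonneg_pos)
    have "Cauchy ts" using ts_lim by (rule LIMSEQ_imp_Cauchy)
    then obtain N where N: "\<And>m n. m \<ge> N \<Longrightarrow> n \<ge> N \<Longrightarrow> dist (ts m) (ts n) < e / M"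
      using \<open>e > 0\<close> \<open>M > 0\<close> metric_CauchyD[of ts "e / M"] by fastforce
    show "\<exists>N. \<forall>m\<ge>N. \<forall>n\<ge>N. dist (k m) (k n) < e"
    proof (intro exI[of _ N] allI impI)
      fix m n assume "m \<ge> N" "n \<ge> N"
      have "dist (k m) (k n) \<le> \<bar>ts m - ts n\<bar> * (4 * norm q / d)"
        using lip by (simp add: dist_norm)
      also have "\<dots> \<le> \<bar>ts m - ts n\<bar> * M" by (intro mult_left_mono) (auto simp: M_def)
      also have "\<dots> < e / M * M"
        using N[OF \<open>m \<ge> N\<close> \<open>n \<ge> N\<close>] \<open>M > 0\<close> by (intro mult_strict_right_mono) (auto simp: dist_real_def)
      finally show "dist (k m) (k n) < e" using \<open>M > 0\<close> by simp
    qed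
  qed
  then obtain k' where k': "k \<longlonglongrightarrow> k'" using Cauchy_convergent_iff convergent_def by blast
  have kD: "k n \<in> D" for n
    unfolding k using lins(1) lins(4)[OF lins(1) lins(3)[OF r(1)]] by (metis diff_0)
  have Bk: "B (k n) = - (complex_of_real (ts n) *\<^sub>C B (r n))" for n
    unfolding k using lins(7)[OF lins(1) lins(3)[OF r(1)], of "complex_of_real (ts n)" n]
      lins(6)[OF r(1)] lins(8) by simp
  have Bk_lim: "(\<lambda>n. B (k n)) \<longlonglongrightarrow> 0"
  proof (rule Lim_null_comparison)
    show "\<forall>\<^sub>F n in sequentially. norm (B (k n)) \<le> ts n * (2 * norm q)"
      using mult_left_mono[OF nBr] ts(1) by (auto simp: Bk norm_scaleC less_imp_le)
    show "(\<lambda>n. ts n * (2 * norm q)) \<longlonglongrightarrow> 0"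
      using tendsto_mult_left_zero[OF ts_lim] .
  qed
  have "k' \<in> D" "B k' = 0" by (rule self_adjoint_closed[OF sa kD k' Bk_lim])+
  then have "k' \<in> eigenspace D B 0" by (simp add: eigenspace_def)
  then have qk: "cinner q k' = 0" by (rule orth)
  \<comment> \<open>Since both \<open>q\<close> and \<open>k n\<close> are in \<open>D\<close>, so
    is \<open>B (r n)\<close>, and the estimate on the range applies to \<open>r n\<close>.\<close>
  have "d * norm (q - k n) \<le> norm (B q - B (k n))" for n
  proof -
    have *: "B (r n) = q - k n" by (simp add: k_def)
    have "B (r n) \<in> D" unfolding * by (rule lins(4)[OF q kD])
    from range[OF r(1) this] show ?thesis unfolding * lins(7)[OF q kD] .
  qed
  moreover have "(\<lambda>n. d * norm (q - k n)) \<longlonglongrightarrow> d * norm (q - k')"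
    by (intro tendsto_intros k')
  moreover have "(\<lambda>n. norm (B q - B (k n))) \<longlonglongrightarrow> norm (B q - 0)"
    by (intro tendsto_intros Bk_lim)
  ultimately have "d * norm (q - k') \<le> norm (B q)"
    using LIMSEQ_le by (metis (no_types, lifting) diff_zero)
  \<comment> \<open>Subtracting a vector orthogonal to \<open>q\<close> cannot shorten
    \<open>q\<close>.\<close>
  moreover have "(norm q)\<^sup>2 \<le> (norm (q - k'))\<^sup>2"
    unfolding norm_diff_sq by (simp add: qk)
  then have "d * norm q \<le> d * norm (q - k')"
    using d by (intro mult_left_mono power2_le_imp_le[of "norm q"]) auto
  ultimately show ?thesis by simp
qed

subsection \<open>Orthonormal sets and orthogonal projections\<close>

text \<open>The vectors serve as their own indices, since the eigenspace comes without an enumerated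
  basis; the bases of the trial spaces enter as images of their index sets.\<close>

definition orthonormal_set :: "'a::complex_hilbert set \<Rightarrow> bool" where
  "orthonormal_set C \<longleftrightarrow> finite C \<and> (\<forall>c\<in>C. \<forall>c'\<in>C. cinner c c' = (if c = c' then 1 else 0))"

lemma cinner_zero_cspan:
  assumes "\<And>c. c \<in> C \<Longrightarrow> cinner x c = 0" "y \<in> cspan C"
  shows "cinner x y = 0"
  using assms(2)
proof (induction rule: complex_vector.span_induct_alt)
  case base
  show ?case by simp
next
  case (step c u v)
  then show ?case by (simp add: cinner_simps assms(1))
qed

lemma orthonormal_set_ortho:
  assumes "orthonormal_set C" "y \<in> cspan C"
  shows "cinner (x - (\<Sum>c\<in>C. cinner x c *\<^sub>C c)) y = 0"
proof (rule cinner_zero_cspan[OF _ assms(2)])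
  fix b assume b: "b \<in> C"
  have "(\<Sum>c\<in>C. cinner x c * cinner c b) = (\<Sum>c\<in>C. if c = b then cinner x c else 0)"
    using assms(1) b by (intro sum.cong) (auto simp: orthonormal_set_def)
  also have "\<dots> = cinner x b"
    using assms(1) b by (simp add: orthonormal_set_def)
  finally show "cinner (x - (\<Sum>c\<in>C. cinner x c *\<^sub>C c)) b = 0"
    by (simp add: cinner_diff_left cinner_sum_left cinner_scaleC_left)
qed

lemma sum_scaleC_in_cspan: "(\<Sum>c\<in>C. f c *\<^sub>C c) \<in> cspan C"
  by (intro complex_vector.span_sum complex_vector.span_scale complex_vector.span_base)

text \<open>\<open>orth_proj\<close> is a definite description, so uniqueness has to be shown: two
  candidates differ by a vector of the span that is orthogonal to the span, hence to itself. From
  here on the Fourier sum replaces the description.\<close>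

lemma orth_proj_cspan:
  assumes "orthonormal_set C"
  shows "orth_proj (cspan C) x = (\<Sum>c\<in>C. cinner x c *\<^sub>C c)"
  unfolding orth_proj_def
proof (rule the_equality)
  show "(\<Sum>c\<in>C. cinner x c *\<^sub>C c) \<in> cspan C \<and>
      (\<forall>w\<in>cspan C. cinner (x - (\<Sum>c\<in>C. cinner x c *\<^sub>C c)) w = 0)"
    using sum_scaleC_in_cspan orthonormal_set_ortho[OF assms] by blast
next
  fix v assume v: "v \<in> cspan C \<and> (\<forall>w\<in>cspan C. cinner (x - v) w = 0)"
  define y where "y = (\<Sum>c\<in>C. cinner x c *\<^sub>C c)"
  have y: "y \<in> cspan C" "cinner (x - y) w = 0" if "w \<in> cspan C" for w
    unfolding y_def using sum_scaleC_in_cspan orthonormal_set_ortho[OF assms] that by blast+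
  have mem: "v - y \<in> cspan C"
    using v y(1)[of 0] complex_vector.span_zero by (blast intro: complex_vector.span_diff)
  have "cinner (v - y) (v - y) = cinner (x - y) (v - y) - cinner (x - v) (v - y)"
    by (simp add: cinner_diff_left)
  also have "\<dots> = 0" using y(2)[OF mem] v mem by simp
  finally show "v = y" by (simp add: cinner_self)
qed

lemma orth_proj_props:
  assumes "orthonormal_set C"
  shows orth_proj_in: "orth_proj (cspan C) x \<in> cspan C"
    and orth_proj_ortho: "y \<in> cspan C \<Longrightarrow> cinner (x - orth_proj (cspan C) x) y = 0"
    and orth_proj_add: "orth_proj (cspan C) (x + z) = orth_proj (cspan C) x + orth_proj (cspan C) z"
    and orth_proj_scale: "orth_proj (cspan C) (a *\<^sub>C x) = a *\<^sub>C orth_proj (cspan C) x"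
    and norm_orth_proj_le: "norm (orth_proj (cspan C) x) \<le> norm x"
    and orth_proj_ident: "y \<in> cspan C \<Longrightarrow> orth_proj (cspan C) y = y"
proof -
  let ?P = "orth_proj (cspan C)"
  note P = orth_proj_cspan[OF assms]
  show mem: "?P x \<in> cspan C" for x
    unfolding P by (rule sum_scaleC_in_cspan)
  show ortho: "cinner (x - ?P x) y = 0" if "y \<in> cspan C" for x y
    unfolding P using orthonormal_set_ortho[OF assms that] .
  show "?P (x + z) = ?P x + ?P z"
    by (simp add: P cinner_add_left scaleC_add_left sum.distrib)
  show "?P (a *\<^sub>C x) = a *\<^sub>C ?P x"
    by (simp add: P cinner_scaleC_left complex_vector.scale_sum_right)
  have "(norm (x - ?P x + ?P x))\<^sup>2 = (norm (x - ?P x))\<^sup>2 + (norm (?P x))\<^sup>2"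
    unfolding norm_add_sq using ortho[OF mem] by simp
  then have "(norm (?P x))\<^sup>2 \<le> (norm x)\<^sup>2" by simp
  then show "norm (?P x) \<le> norm x" by (rule power2_le_imp_le) simp
  show "?P y = y" if y: "y \<in> cspan C"
  proof -
    have "y - ?P y \<in> cspan C" using y mem by (rule complex_vector.span_diff)
    then have "cinner (y - ?P y) (y - ?P y) = 0" by (rule ortho)
    then show ?thesis by (simp add: cinner_self)
  qed
qed

lemma Gram_Schmidt:
  assumes "finite B"
  shows "\<exists>C. orthonormal_set C \<and> cspan C = cspan B"
  using assms
proof (induction B)
  case empty
  show ?case by (intro exI[of _ "{}"]) (simp add: orthonormal_set_def)
next
  case (insert b B)
  then obtain C where C: "orthonormal_set C" "cspan C = cspan B" by blast
  define y where "y = b - orth_proj (cspan C) b"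
  have span: "cspan (insert b B) = cspan (insert b C)"
    by (simp only: complex_vector.span_insert C(2))
  show ?case
  proof (cases "y = 0")
    case True
    then have "b \<in> cspan C" using orth_proj_in[OF C(1), of b] by (simp add: y_def)
    then show ?thesis
      using C(1) span complex_vector.span_redundant[of b C] by (intro exI[of _ C]) simp
  next
    case False
    define c where "c = complex_of_real (1 / norm y) *\<^sub>C y"
    have "norm c = 1" using False by (simp add: c_def norm_scaleC norm_divide)
    then have cc: "cinner c c = 1" by (simp add: cinner_self)
    have cu: "cinner c u = 0" if "u \<in> cspan C" for u
      using orth_proj_ortho[OF C(1) that, of b] by (simp add: c_def y_def cinner_scaleC_left)
    have uc: "cinner u c = 0" if "u \<in> cspan C" for u
      using cu[OF that] by (subst cinner_commute) simp
    have base: "u \<in> cspan C" if "u \<in> C" for u using that by (rule complex_vector.span_base)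
    have ons: "orthonormal_set (insert c C)"
      using C(1) cc cu[OF base] uc[OF base] by (auto simp: orthonormal_set_def)
    have b_eq: "b = complex_of_real (norm y) *\<^sub>C c + orth_proj (cspan C) b"
      using False by (simp add: c_def scaleC_scaleC scaleC_one y_def)
    have sub: "cspan C \<subseteq> cspan (insert z C)" for z
      by (rule complex_vector.span_mono) blast
    have "cspan (insert c C) = cspan (insert b C)"
    proof (rule complex_vector.span_subspace[symmetric, OF _ _ complex_vector.subspace_span])
      show "insert b C \<subseteq> cspan (insert c C)"
      proof -
        have "b \<in> cspan (insert c C)"
          by (subst b_eq, rule complex_vector.span_add[OF complex_vector.span_scale[OF
                complex_vector.span_base] subsetD[OF sub orth_proj_in[OF C(1)]]]) simp
        then show ?thesis using base sub by blast
      qed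
      have "c \<in> cspan (insert b C)"
        unfolding c_def y_def
        by (intro complex_vector.span_diff complex_vector.span_scale complex_vector.span_base
            subsetD[OF sub orth_proj_in[OF C(1)]]) simp
      then show "cspan (insert c C) \<subseteq> cspan (insert b C)"
        using base sub by (intro complex_vector.span_minimal complex_vector.subspace_span) blast
    qed
    then show ?thesis using ons span by blast
  qed
qed

text \<open>The finite set provided by \<open>finite_dimensional\<close> need not lie in
  \<open>E\<close>, so orthonormalising it could produce a larger space. A basis is chosen inside
  \<open>E\<close> instead; it is finite because it is independent within a finite span.\<close>

lemma finite_dimensional_orthonormal:
  assumes "csubspace E" "finite_dimensional E"
  obtains C where "orthonormal_set C" "cspan C = E"
proof -
  obtain T where T: "finite T" "E \<subseteq> cspan T" using assms(2) by (auto simp: finite_dimensional_def)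
  obtain B where B: "B \<subseteq> E" "\<not> complex_vector.dependent B" "E \<subseteq> cspan B"
    using complex_vector.basis_exists[of E] by metis
  have "finite B"
    using complex_vector.independent_span_bound[OF T(1) B(2)] B(1) T(2) by blast
  moreover have "cspan B = E"
    using B assms(1) complex_vector.span_subspace by blast
  ultimately show thesis using Gram_Schmidt[of B] that by auto
qed

text \<open>Expanding \<open>u\<close> in \<open>C\<close>, whose coefficients are at most
  \<open>norm u\<close>, turns pointwise convergence on finitely many basis vectors into convergence
  uniform on the unit ball. The threshold \<open>m\<close> is there because the trial spaces are
  specified only from index 1 on.\<close>

lemma uniform_null_on_cspan:
  assumes C: "orthonormal_set C"
    and add: "\<And>n u v. n \<ge> m \<Longrightarrow> F n (u + v) = F n u + F n v"
    and scale: "\<And>n a u. n \<ge> m \<Longrightarrow> F n (a *\<^sub>C u) = a *\<^sub>C F n u"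
    and null: "\<And>c. c \<in> C \<Longrightarrow> (\<lambda>n. norm (F n c)) \<longlonglongrightarrow> 0"
    and \<eta>: "\<eta> > 0"
  shows "\<exists>N::nat. \<forall>n>N. \<forall>u\<in>cspan C. norm (F n u) \<le> \<eta> * norm (u :: 'a::complex_hilbert)"
proof -
  have fin: "finite C" using C by (simp add: orthonormal_set_def)
  have "(\<lambda>n. \<Sum>c\<in>C. norm (F n c)) \<longlonglongrightarrow> (\<Sum>c\<in>C. 0)"
    by (intro tendsto_sum null)
  then have "\<forall>\<^sub>F n in sequentially. (\<Sum>c\<in>C. norm (F n c)) < \<eta>"
    using \<eta> by (intro order_tendstoD(2)) auto
  then obtain N where N: "\<And>n. n \<ge> N \<Longrightarrow> (\<Sum>c\<in>C. norm (F n c)) < \<eta>"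
    by (auto simp: eventually_sequentially)
  have "norm (F n u) \<le> \<eta> * norm u" if n: "n \<ge> max N m" and u: "u \<in> cspan C" for n u
  proof -
    have F0: "F n 0 = 0" using scale[of n 0 0] n by simp
    have Fsum: "F n (\<Sum>c\<in>I. f c *\<^sub>C c) = (\<Sum>c\<in>I. f c *\<^sub>C F n c)" if "finite I" for f I
      using that by (induction I) (use n in \<open>simp_all add: F0 add scale\<close>)
    have "u = (\<Sum>c\<in>C. cinner u c *\<^sub>C c)"
      using orth_proj_ident[OF C u] orth_proj_cspan[OF C] by metis
    then have "F n u = (\<Sum>c\<in>C. cinner u c *\<^sub>C F n c)"
      using Fsum[OF fin, of "cinner u"] by metis
    also have "norm \<dots> \<le> (\<Sum>c\<in>C. norm u * norm (F n c))"
    proof (rule sum_norm_le)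
      fix c assume "c \<in> C"
      then have "cinner c c = 1" using C by (simp add: orthonormal_set_def)
      then have "(norm c)\<^sup>2 = 1" using Re_cinner_self[of c] by simp
      then have "norm c = 1" using norm_ge_zero[of c] unfolding power2_eq_1_iff by linarith
      then have "cmod (cinner u c) \<le> norm u" using norm_cinner_le[of u c] by simp
      then show "norm (cinner u c *\<^sub>C F n c) \<le> norm u * norm (F n c)"
        by (simp add: norm_scaleC mult_right_mono)
    qed
    also have "\<dots> = norm u * (\<Sum>c\<in>C. norm (F n c))" by (simp add: sum_distrib_left)
    also have "\<dots> \<le> norm u * \<eta>" using N[of n] n by (intro mult_left_mono) auto
    finally show ?thesis by (simp add: mult.commute)
  qed
  then show ?thesis by (intro exI[of _ "max N m"]) auto
qed

subsection \<open>The lower bound for the quadratic pencil\<close>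

text \<open>For symmetric \<open>B\<close> and arguments in its domain this is the inner product of
  \<open>(B - s) w\<close> and \<open>(B - cnj s) x\<close>. The conjugate in the second factor
  makes the form holomorphic in \<open>s\<close>, and for nonreal \<open>s\<close> it destroys
  Hermitian symmetry.\<close>

definition pencil_form :: "('a::complex_hilbert \<Rightarrow> 'a) \<Rightarrow> complex \<Rightarrow> 'a \<Rightarrow> 'a \<Rightarrow> complex" where
  "pencil_form B s w x = cinner (B w) (B x) - 2 * s * cinner (B w) x + s\<^sup>2 * cinner w x"

lemma pencil_form_linear:
  assumes "linear_operator D B" "u \<in> D" "v \<in> D"
  shows pencil_form_add_left: "pencil_form B s (u + v) x = pencil_form B s u x + pencil_form B s v x"
    and pencil_form_add_right: "pencil_form B s x (u + v) = pencil_form B s x u + pencil_form B s x v"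
    and pencil_form_scale_left: "pencil_form B s (a *\<^sub>C u) x = a * pencil_form B s u x"
    and pencil_form_scale_right: "pencil_form B s x (a *\<^sub>C u) = cnj a * pencil_form B s x u"
  using assms by (simp_all add: pencil_form_def linear_operatorD[OF assms(1)] cinner_simps algebra_simps)

text \<open>The spectral parameter lies so close to the eigenvalue, relative to the gap \<open>d\<close>, that the form
  is coercive on the orthogonal complement of the eigenspace.\<close>

lemma Re_pencil_form_coercive:
  assumes sa: "self_adjoint D B"
    and gap: "\<And>q. q \<in> D \<Longrightarrow> (\<And>k. k \<in> eigenspace D B 0 \<Longrightarrow> cinner q k = 0) \<Longrightarrow> d * norm q \<le> norm (B q)"
    and C: "orthonormal_set C" "eigenspace D B 0 = cspan C"
    and g: "g \<in> D" and s: "cmod s \<le> d / 4"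
  shows "d\<^sup>2 / 4 * (norm (g - orth_proj (cspan C) g))\<^sup>2 - (cmod s)\<^sup>2 * (norm (orth_proj (cspan C) g))\<^sup>2
    \<le> Re (pencil_form B s g g)"
proof -
  note lins = linear_operatorD[OF self_adjoint_linear[OF sa]]
  define h where "h = orth_proj (cspan C) g"
  define q where "q = g - h"
  have hE: "h \<in> cspan C" unfolding h_def by (rule orth_proj_in[OF C(1)])
  then have h: "h \<in> D" "B h = 0" using C(2) by (auto simp: eigenspace_def)
  have qD: "q \<in> D" unfolding q_def using g h by (simp add: lins)
  have qE: "cinner q k = 0" if "k \<in> cspan C" for k
    using orth_proj_ortho[OF C(1) that] by (simp add: q_def h_def)
  have Bg: "B g = B q" unfolding q_def using g h by (simp add: lins)
  have gq: "g = q + h" by (simp add: q_def)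
  have Bqh: "cinner (B q) h = 0" using self_adjoint_symmetric[OF sa qD h(1)] h by simp
  have Bqg: "cinner (B q) g = cinner (B q) q"
    by (simp add: gq cinner_add_right Bqh)
  have ng: "(norm g)\<^sup>2 = (norm q)\<^sup>2 + (norm h)\<^sup>2"
    unfolding gq norm_add_sq using qE[OF hE] by simp
  define X Y where "X = norm (B q)" and "Y = norm q"
  have XY: "d * Y \<le> X" unfolding X_def Y_def using qE C(2) by (intro gap[OF qD]) auto
  have d: "d \<ge> 0" using s norm_ge_zero[of s] by linarith
  have nn: "X \<ge> 0" "Y \<ge> 0" by (auto simp: X_def Y_def)
  \<comment> \<open>This is where the radius \<open>d / 4\<close> enters: together with the gap it
    bounds \<open>s\<close> times the component \<open>q\<close> by a quarter of
    \<open>norm (B q)\<close>.\<close>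
  have "cmod s * Y \<le> d / 4 * Y" using s nn by (intro mult_right_mono)
  then have sY: "cmod s * Y \<le> X / 4" using XY by simp
  have "Re (pencil_form B s g g) = X\<^sup>2 - Re (2 * s * cinner (B q) q) + Re (s\<^sup>2) * (Y\<^sup>2 + (norm h)\<^sup>2)"
    by (simp add: pencil_form_def Bg Bqg cinner_self[of g] ng X_def Y_def Re_cinner_self flip: of_real_power)
  moreover have "Re (2 * s * cinner (B q) q) \<le> X\<^sup>2 / 2"
  proof -
    have "Re (2 * s * cinner (B q) q) \<le> 2 * cmod s * cmod (cinner (B q) q)"
      using complex_Re_le_cmod[of "2 * s * cinner (B q) q"] by (simp add: norm_mult)
    also have "\<dots> \<le> 2 * cmod s * (X * Y)"
      unfolding X_def Y_def by (intro mult_left_mono norm_cinner_le) auto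
    also have "\<dots> = 2 * (cmod s * Y) * X" by simp
    also have "\<dots> \<le> 2 * (X / 4) * X" using sY nn by (intro mult_right_mono mult_left_mono) auto
    finally show ?thesis by (simp add: power2_eq_square)
  qed
  moreover have "- ((X / 4)\<^sup>2 + (cmod s)\<^sup>2 * (norm h)\<^sup>2) \<le> Re (s\<^sup>2) * (Y\<^sup>2 + (norm h)\<^sup>2)"
  proof -
    have "(cmod s * Y)\<^sup>2 \<le> (X / 4)\<^sup>2" using sY nn by (intro power_mono) auto
    then have "- ((X / 4)\<^sup>2 + (cmod s)\<^sup>2 * (norm h)\<^sup>2) \<le> - (cmod s)\<^sup>2 * (Y\<^sup>2 + (norm h)\<^sup>2)"
      by (simp add: power_mult_distrib algebra_simps)
    also have "\<dots> \<le> Re (s\<^sup>2) * (Y\<^sup>2 + (norm h)\<^sup>2)"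
      using complex_Re_le_cmod[of "- (s\<^sup>2)"] by (intro mult_right_mono) (auto simp: norm_power)
    finally show ?thesis .
  qed
  moreover have "(d * Y)\<^sup>2 \<le> X\<^sup>2" using XY d nn by (intro power_mono) auto
  moreover have "0 \<le> (d * Y)\<^sup>2" "(X / 4)\<^sup>2 = X\<^sup>2 / 16" "d\<^sup>2 / 4 * Y\<^sup>2 = (d * Y)\<^sup>2 / 4"
    by (simp_all add: power_mult_distrib power_divide)
  \<comment> \<open>The cross term costs half of \<open>X\<^sup>2\<close> and the quadratic term a
    sixteenth. The remaining 7/16 of \<open>X\<^sup>2\<close> exceeds a quarter of
    \<open>(d * Y)\<^sup>2\<close>.\<close>
  ultimately have "d\<^sup>2 / 4 * Y\<^sup>2 - (cmod s)\<^sup>2 * (norm h)\<^sup>2 \<le> Re (pencil_form B s g g)"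
    by linarith
  then show ?thesis by (simp add: Y_def q_def h_def)
qed

text \<open>The test vector is \<open>w = g + \<theta> p'\<close>, where \<open>p'\<close> approximates the eigenspace component of \<open>x\<close>
  within the trial space, \<open>g = x - p'\<close> and the phase \<open>\<theta>\<close> makes \<open>\<theta> s\<^sup>2\<close> positive.\<close>

lemma pencil_form_lower_bound:
  assumes sa: "self_adjoint D B"
    and gap: "\<And>q. q \<in> D \<Longrightarrow> (\<And>k. k \<in> eigenspace D B 0 \<Longrightarrow> cinner q k = 0) \<Longrightarrow> d * norm q \<le> norm (B q)"
    and C: "orthonormal_set C" "eigenspace D B 0 = cspan C"
    and F: "orthonormal_set F" "cspan F \<subseteq> D" and x: "x \<in> cspan F"
    and H1: "\<And>u. u \<in> cspan C \<Longrightarrow> norm (orth_proj (cspan F) u - u) \<le> \<rho> * norm u"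
    and H2: "\<And>u. u \<in> cspan C \<Longrightarrow> norm (B (orth_proj (cspan F) u)) \<le> \<rho> * norm u"
    and H3: "\<And>u w. u \<in> cspan C \<Longrightarrow> w \<in> cspan F \<Longrightarrow>
      cmod (cinner (B (orth_proj (cspan F) u)) (B w)) \<le> \<rho> * norm u * norm w"
    and s: "\<delta> \<le> cmod s" "cmod s \<le> d / 4" and \<delta>: "0 < \<delta>"
    and \<rho>: "0 \<le> \<rho>" "\<rho> \<le> 1 / 4" "72 * ((1 + d / 4)\<^sup>2 * \<rho>) \<le> \<delta>\<^sup>2"
  shows "\<exists>w\<in>cspan F. norm w \<le> 3 * norm x \<and> \<delta>\<^sup>2 / 8 * (norm x)\<^sup>2 \<le> cmod (pencil_form B s w x)"
proof -
  note lin = self_adjoint_linear[OF sa]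
  note lins = linear_operatorD[OF lin]
  define N where "N = norm x"
  define p where "p = orth_proj (cspan C) x"
  define p' where "p' = orth_proj (cspan F) p"
  define g where "g = x - p'"
  define h where "h = orth_proj (cspan C) g"
  define q where "q = g - h"
  define \<theta> where "\<theta> = cnj s / s"
  define \<kappa> where "\<kappa> = (1 + d / 4)\<^sup>2 * \<rho>"
  have N: "N \<ge> 0" by (simp add: N_def)
  have s0: "s \<noteq> 0" using s \<delta> by auto
  have d: "d > 0" using s \<delta> by linarith
  have pE: "p \<in> cspan C" unfolding p_def by (rule orth_proj_in[OF C(1)])
  have p'L: "p' \<in> cspan F" unfolding p'_def by (rule orth_proj_in[OF F(1)])
  have gL: "g \<in> cspan F" unfolding g_def using x p'L by (rule complex_vector.span_diff)
  have memD: "p' \<in> D" "g \<in> D" "x \<in> D" using p'L gL x F(2) by auto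
  have pN: "norm p \<le> N" unfolding p_def N_def by (rule norm_orth_proj_le[OF C(1)])
  have p'p: "norm p' \<le> norm p" unfolding p'_def by (rule norm_orth_proj_le[OF F(1)])
  have \<rho>p: "\<rho> * norm p \<le> \<rho> * N" using pN \<rho>(1) by (rule mult_left_mono)
  have e1: "norm (p' - p) \<le> \<rho> * N" using H1[OF pE] \<rho>p unfolding p'_def by linarith
  have e2: "norm (B p') \<le> \<rho> * N" using H2[OF pE] \<rho>p unfolding p'_def by linarith
  have e3: "cmod (cinner (B p') (B w)) \<le> \<rho> * N * norm w" if "w \<in> cspan F" for w
    using H3[OF pE that] mult_right_mono[OF \<rho>p norm_ge_zero[of w]] unfolding p'_def by linarith
  have gN: "norm g \<le> 2 * N"
    using norm_triangle_ineq4[of x p'] p'p pN unfolding g_def N_def by linarith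
  \<comment> \<open>Removing \<open>p'\<close> instead of \<open>p\<close> from \<open>x\<close>
    leaves an eigenspace component, but it is exactly the projection of the approximation error
    \<open>p - p'\<close>.\<close>
  have hN: "norm h \<le> \<rho> * N"
  proof -
    have "orth_proj (cspan C) (p - p') + orth_proj (cspan C) p' = p"
      using orth_proj_add[OF C(1), of "p - p'" p'] orth_proj_ident[OF C(1) pE] by simp
    moreover have "h + orth_proj (cspan C) p' = p"
      using orth_proj_add[OF C(1), of g p'] by (simp add: h_def g_def p_def)
    ultimately have "h = orth_proj (cspan C) (p - p')"
      by (metis add_right_cancel)
    then have "norm h \<le> norm (p - p')" using norm_orth_proj_le[OF C(1)] by simp
    then show ?thesis using e1 by (simp add: norm_minus_commute)
  qed
  \<comment> \<open>The three terms of the form contribute 1, \<open>2 * cmod s\<close> and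
    \<open>(cmod s)\<^sup>2\<close> times \<rho>; their sum is a square, and \<kappa> is its value
    at the largest admissible \<open>s\<close>.\<close>
  have s\<rho>: "(1 + cmod s)\<^sup>2 * \<rho> \<le> \<kappa>"
    unfolding \<kappa>_def using s(2) \<rho>(1) by (intro mult_right_mono power_mono) auto
  have s\<rho>': "(cmod s)\<^sup>2 * \<rho> \<le> \<kappa>"
  proof -
    have "(cmod s)\<^sup>2 * \<rho> \<le> (1 + cmod s)\<^sup>2 * \<rho>"
      using \<rho>(1) by (intro mult_right_mono power_mono) auto
    then show ?thesis using s\<rho> by linarith
  qed
  \<comment> \<open>Since \<open>B p'\<close> is small both in norm and against \<open>B y\<close>,
    only the last term of the form survives, and there \<open>p'\<close> may be replaced by
    \<open>p\<close>.\<close>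
  have near: "cmod (pencil_form B s p' y - s\<^sup>2 * cinner p y) \<le> \<kappa> * N * norm y"
    if y: "y \<in> cspan F" for y
  proof -
    have "pencil_form B s p' y - s\<^sup>2 * cinner p y
        = cinner (B p') (B y) - 2 * s * cinner (B p') y + s\<^sup>2 * cinner (p' - p) y"
      by (simp add: pencil_form_def cinner_diff_left algebra_simps)
    also have "cmod \<dots> \<le> cmod (cinner (B p') (B y)) + 2 * cmod s * cmod (cinner (B p') y)
        + (cmod s)\<^sup>2 * cmod (cinner (p' - p) y)"
      by (rule order_trans[OF norm_triangle_ineq], intro add_mono,
          rule order_trans[OF norm_triangle_ineq4]) (auto simp: norm_mult norm_power)
    also have "\<dots> \<le> \<rho> * N * norm y + 2 * cmod s * (\<rho> * N * norm y) + (cmod s)\<^sup>2 * (\<rho> * N * norm y)"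
      by (intro add_mono mult_left_mono e3[OF y] order_trans[OF norm_cinner_le]
          mult_right_mono e1 e2) auto
    also have "\<dots> = ((1 + cmod s)\<^sup>2 * \<rho>) * (N * norm y)"
      by (simp add: power2_eq_square algebra_simps)
    also have "\<dots> \<le> \<kappa> * (N * norm y)" using s\<rho> N by (intro mult_right_mono) auto
    finally show ?thesis by (simp add: mult.assoc)
  qed
  have near': "cmod (pencil_form B s y p' - s\<^sup>2 * cinner y p) \<le> \<kappa> * N * norm y"
    if y: "y \<in> cspan F" for y
  proof -
    have yD: "y \<in> D" using y F(2) by auto
    have "pencil_form B s y p' - s\<^sup>2 * cinner y p
        = cinner (B y) (B p') - 2 * s * cinner y (B p') + s\<^sup>2 * cinner y (p' - p)"
      by (simp add: pencil_form_def cinner_diff_right self_adjoint_symmetric[OF sa yD memD(1)]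
          algebra_simps)
    also have "cmod \<dots> \<le> cmod (cinner (B y) (B p')) + 2 * cmod s * cmod (cinner y (B p'))
        + (cmod s)\<^sup>2 * cmod (cinner y (p' - p))"
      by (rule order_trans[OF norm_triangle_ineq], intro add_mono,
          rule order_trans[OF norm_triangle_ineq4]) (auto simp: norm_mult norm_power)
    also have "\<dots> \<le> \<rho> * N * norm y + 2 * cmod s * (\<rho> * N * norm y) + (cmod s)\<^sup>2 * (\<rho> * N * norm y)"
    proof (intro add_mono mult_left_mono)
      show "cmod (cinner (B y) (B p')) \<le> \<rho> * N * norm y"
        using e3[OF y] by (subst cinner_commute) simp
      show "cmod (cinner y (B p')) \<le> \<rho> * N * norm y"
        using norm_cinner_le[of y "B p'"] mult_left_mono[OF e2 norm_ge_zero[of y]]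
        by (simp add: mult_ac)
      show "cmod (cinner y (p' - p)) \<le> \<rho> * N * norm y"
        using norm_cinner_le[of y "p' - p"] mult_left_mono[OF e1 norm_ge_zero[of y]]
        by (simp add: mult_ac)
    qed auto
    also have "\<dots> = ((1 + cmod s)\<^sup>2 * \<rho>) * (N * norm y)"
      by (simp add: power2_eq_square algebra_simps)
    also have "\<dots> \<le> \<kappa> * (N * norm y)" using s\<rho> N by (intro mult_right_mono) auto
    finally show ?thesis by (simp add: mult.assoc)
  qed
  have \<kappa>: "\<kappa> \<ge> 0" unfolding \<kappa>_def using \<rho>(1) by simp
  have \<kappa>N: "\<kappa> * N * norm y \<le> c * \<kappa> * N\<^sup>2" if "norm y \<le> c * N" for y :: 'a and c
    using mult_left_mono[OF that, of "\<kappa> * N"] \<kappa> N by (simp add: power2_eq_square mult_ac)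
  have px: "cinner p (x - p) = 0"
    using orth_proj_ortho[OF C(1) pE, of x] unfolding p_def[symmetric]
    by (subst cinner_commute) simp
  \<comment> \<open>Both pieces of \<open>g = (x - p) - (p' - p)\<close> are harmless: the first is
    orthogonal to \<open>p\<close>, the second is small.\<close>
  have pg: "cmod (cinner p g) \<le> \<rho> * N\<^sup>2"
  proof -
    have "g = (x - p) - (p' - p)" by (simp add: g_def)
    then have "cinner p g = - cinner p (p' - p)"
      using px by (simp only: cinner_diff_right[of p "x - p"]) simp
    then have "cmod (cinner p g) \<le> norm p * norm (p' - p)" using norm_cinner_le by simp
    also have "\<dots> \<le> N * (\<rho> * N)" using pN e1 N by (intro mult_mono) auto
    finally show ?thesis by (simp add: power2_eq_square mult_ac)
  qed
  have spg: "cmod (s\<^sup>2 * cinner p g) \<le> \<kappa> * N\<^sup>2" "cmod (s\<^sup>2 * cinner g p) \<le> \<kappa> * N\<^sup>2"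
  proof -
    have "(cmod s)\<^sup>2 * cmod (cinner p g) \<le> (cmod s)\<^sup>2 * (\<rho> * N\<^sup>2)"
      using pg by (intro mult_left_mono) auto
    also have "\<dots> = ((cmod s)\<^sup>2 * \<rho>) * N\<^sup>2" by simp
    also have "\<dots> \<le> \<kappa> * N\<^sup>2" using s\<rho>' by (intro mult_right_mono) auto
    finally show "cmod (s\<^sup>2 * cinner p g) \<le> \<kappa> * N\<^sup>2" by (simp add: norm_mult norm_power)
    moreover have "cmod (cinner g p) = cmod (cinner p g)" by (subst cinner_commute) simp
    ultimately show "cmod (s\<^sup>2 * cinner g p) \<le> \<kappa> * N\<^sup>2" by (simp add: norm_mult)
  qed
  have \<theta>: "cmod \<theta> = 1" "\<theta> * s\<^sup>2 = complex_of_real ((cmod s)\<^sup>2)"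
    unfolding complex_norm_square using s0 by (simp_all add: \<theta>_def norm_divide power2_eq_square)
  have T1: "d\<^sup>2 / 4 * (norm q)\<^sup>2 - \<kappa> * N\<^sup>2 \<le> Re (pencil_form B s g g)"
  proof -
    have "(cmod s)\<^sup>2 * (norm h)\<^sup>2 \<le> (cmod s)\<^sup>2 * (\<rho> * N)\<^sup>2"
      using hN by (intro mult_left_mono power_mono) auto
    also have "\<dots> = ((cmod s)\<^sup>2 * \<rho>) * \<rho> * N\<^sup>2" by (simp add: power2_eq_square)
    also have "\<dots> \<le> \<kappa> * 1 * N\<^sup>2" using s\<rho>' \<rho> \<kappa> by (intro mult_right_mono mult_mono) auto
    finally show ?thesis
      using Re_pencil_form_coercive[OF sa gap C memD(2) s(2)] unfolding q_def h_def by simp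
  qed
  have T2: "- (3 * \<kappa> * N\<^sup>2) \<le> Re (pencil_form B s g p')"
  proof -
    have "cmod (pencil_form B s g p') \<le> cmod (pencil_form B s g p' - s\<^sup>2 * cinner g p) + cmod (s\<^sup>2 * cinner g p)"
      using norm_triangle_ineq[of "pencil_form B s g p' - s\<^sup>2 * cinner g p" "s\<^sup>2 * cinner g p"] by simp
    then show ?thesis
      using near'[OF gL] \<kappa>N[OF gN] spg abs_Re_le_cmod[of "pencil_form B s g p'"] by linarith
  qed
  have T3: "- (3 * \<kappa> * N\<^sup>2) \<le> Re (\<theta> * pencil_form B s p' g)"
  proof -
    have "cmod (\<theta> * pencil_form B s p' g) = cmod (pencil_form B s p' g)"
      by (simp add: norm_mult \<theta>)
    moreover have "cmod (pencil_form B s p' g) \<le> cmod (pencil_form B s p' g - s\<^sup>2 * cinner p g) + cmod (s\<^sup>2 * cinner p g)"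
      using norm_triangle_ineq[of "pencil_form B s p' g - s\<^sup>2 * cinner p g" "s\<^sup>2 * cinner p g"] by simp
    ultimately show ?thesis
      using near[OF gL] \<kappa>N[OF gN] spg abs_Re_le_cmod[of "\<theta> * pencil_form B s p' g"] by linarith
  qed
  have T4: "(cmod s)\<^sup>2 * (norm p)\<^sup>2 - 2 * \<kappa> * N\<^sup>2 \<le> Re (\<theta> * pencil_form B s p' p')"
  proof -
    define r where "r = pencil_form B s p' p' - s\<^sup>2 * cinner p p'"
    have "cmod (\<theta> * r) \<le> 1 * \<kappa> * N\<^sup>2"
      using near[OF p'L] \<kappa>N[of p' 1] p'p pN by (simp add: norm_mult \<theta> r_def)
    then have r: "- (\<kappa> * N\<^sup>2) \<le> Re (\<theta> * r)" using abs_Re_le_cmod[of "\<theta> * r"] by simp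
    have "cmod (cinner p (p' - p)) \<le> norm p * norm (p' - p)" by (rule norm_cinner_le)
    also have "\<dots> \<le> N * (\<rho> * N)" using pN e1 N by (intro mult_mono) auto
    finally have "- (\<rho> * N\<^sup>2) \<le> Re (cinner p (p' - p))"
      using abs_Re_le_cmod[of "cinner p (p' - p)"] by (simp add: power2_eq_square mult_ac)
    then have "(cmod s)\<^sup>2 * (- (\<rho> * N\<^sup>2)) \<le> (cmod s)\<^sup>2 * Re (cinner p (p' - p))"
      by (intro mult_left_mono) auto
    moreover have "(cmod s)\<^sup>2 * \<rho> * N\<^sup>2 \<le> \<kappa> * N\<^sup>2" using s\<rho>' by (intro mult_right_mono) auto
    ultimately have "- (\<kappa> * N\<^sup>2) \<le> (cmod s)\<^sup>2 * Re (cinner p (p' - p))" by (simp add: mult.assoc)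
    then have "(cmod s)\<^sup>2 * (norm p)\<^sup>2 - \<kappa> * N\<^sup>2 \<le> (cmod s)\<^sup>2 * Re (cinner p p')"
      by (simp add: cinner_diff_right Re_cinner_self right_diff_distrib)
    moreover have "\<theta> * pencil_form B s p' p' = \<theta> * r + complex_of_real ((cmod s)\<^sup>2) * cinner p p'"
      unfolding \<theta>(2)[symmetric] r_def by (simp add: algebra_simps)
    ultimately show ?thesis using r by (simp del: of_real_power)
  qed
  define w where "w = g + \<theta> *\<^sub>C p'"
  have wL: "w \<in> cspan F"
    unfolding w_def using gL p'L by (intro complex_vector.span_add complex_vector.span_scale)
  have wN: "norm w \<le> 3 * N"
    using norm_triangle_ineq[of g "\<theta> *\<^sub>C p'"] gN p'p pN by (simp add: w_def norm_scaleC \<theta>)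
  have xg: "x = g + p'" by (simp add: g_def)
  have "pencil_form B s w x = (pencil_form B s g g + pencil_form B s g p')
      + (\<theta> * pencil_form B s p' g + \<theta> * pencil_form B s p' p')"
    unfolding w_def using memD lins(3)[OF memD(1), of \<theta>] unfolding xg
    by (simp add: pencil_form_linear[OF lin] distrib_left)
  \<comment> \<open>The four blocks lose 1, 3, 3 and 2 multiples of
    \<open>\<kappa> * N\<^sup>2\<close>, which gives the 9.\<close>
  then have "d\<^sup>2 / 4 * (norm q)\<^sup>2 + (cmod s)\<^sup>2 * (norm p)\<^sup>2 - 9 * (\<kappa> * N\<^sup>2) \<le> Re (pencil_form B s w x)"
    using T1 T2 T3 T4 by simp
  moreover have "\<delta>\<^sup>2 * (norm q)\<^sup>2 \<le> d\<^sup>2 / 4 * (norm q)\<^sup>2"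
  proof (rule mult_right_mono)
    have "\<delta>\<^sup>2 \<le> (d / 2)\<^sup>2" using s \<delta> d by (intro power_mono) auto
    then show "\<delta>\<^sup>2 \<le> d\<^sup>2 / 4" by (simp add: power_divide)
  qed simp
  moreover have "\<delta>\<^sup>2 * (norm p)\<^sup>2 \<le> (cmod s)\<^sup>2 * (norm p)\<^sup>2"
    using s \<delta> by (intro mult_right_mono power_mono) auto
  \<comment> \<open>The pieces \<open>p'\<close>, \<open>h\<close>, \<open>q\<close> add up to
    \<open>x\<close>, and \<open>h\<close> is at most a quarter of it, so
    \<open>norm p + norm q\<close> is at least \<open>3 / 4 * N\<close>. After squaring this gives
    the factor 9/32, which is rounded down to 1/4.\<close>
  moreover have "\<delta>\<^sup>2 * (N\<^sup>2 / 4) \<le> \<delta>\<^sup>2 * ((norm p)\<^sup>2 + (norm q)\<^sup>2)"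
  proof (rule mult_left_mono)
    have "x = p' + (h + q)" by (simp add: q_def g_def)
    then have "N \<le> norm p' + (norm h + norm q)"
      unfolding N_def using norm_triangle_ineq[of p' "h + q"] norm_triangle_ineq[of h q] by simp
    moreover have "\<rho> * N \<le> 1 / 4 * N" using \<rho> N by (intro mult_right_mono) auto
    ultimately have "3 / 4 * N \<le> norm p + norm q" using p'p hN by linarith
    then have "(3 / 4 * N)\<^sup>2 \<le> (norm p + norm q)\<^sup>2" using N by (intro power_mono) auto
    moreover have "(norm p + norm q)\<^sup>2 \<le> 2 * ((norm p)\<^sup>2 + (norm q)\<^sup>2)"
      using zero_le_power2[of "norm p - norm q"] by (simp add: power2_eq_square algebra_simps)
    ultimately have "(3 / 4 * N)\<^sup>2 \<le> 2 * ((norm p)\<^sup>2 + (norm q)\<^sup>2)" by (rule order_trans)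
    then have "9 / 16 * N\<^sup>2 \<le> 2 * ((norm p)\<^sup>2 + (norm q)\<^sup>2)"
      unfolding power_mult_distrib by (simp add: power_divide)
    moreover have "b / 4 \<le> y" if "9 / 16 * b \<le> 2 * y" "0 \<le> b" for b y :: real
      using that by linarith
    ultimately show "N\<^sup>2 / 4 \<le> (norm p)\<^sup>2 + (norm q)\<^sup>2" using zero_le_power2 by blast
  qed simp
  \<comment> \<open>With 72 = 8 * 9 the total error is at most
    \<open>\<delta>\<^sup>2 / 8 * N\<^sup>2\<close>, half of the main term
    \<open>\<delta>\<^sup>2 / 4 * N\<^sup>2\<close>.\<close>
  moreover have "72 * (\<kappa> * N\<^sup>2) \<le> \<delta>\<^sup>2 * N\<^sup>2"
    using mult_right_mono[OF \<rho>(3) zero_le_power2[of N]] by (simp add: \<kappa>_def)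
  ultimately have "\<delta>\<^sup>2 / 8 * N\<^sup>2 \<le> Re (pencil_form B s w x)"
    unfolding distrib_left by linarith
  also have "\<dots> \<le> cmod (pencil_form B s w x)" by (rule complex_Re_le_cmod)
  finally show ?thesis using wL wN unfolding N_def by blast
qed

subsection \<open>Quadratic matrix pencils\<close>

lemma euclidean_norm_carrier:
  "v \<in> carrier_vec n \<Longrightarrow> euclidean_norm v = L2_set (\<lambda>i. cmod (vec_index v i)) {..<n}"
  by (auto simp: euclidean_norm_def)

lemma euclidean_norm_nonneg: "0 \<le> euclidean_norm v"
  by (simp add: euclidean_norm_def)

lemma euclidean_norm_add:
  assumes "u \<in> carrier_vec n" "v \<in> carrier_vec n"
  shows "euclidean_norm (u + v) \<le> euclidean_norm u + euclidean_norm v"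
proof -
  have "euclidean_norm (u + v) \<le> L2_set (\<lambda>i. cmod (vec_index u i) + cmod (vec_index v i)) {..<n}"
    using assms unfolding euclidean_norm_carrier[OF add_carrier_vec[OF assms]]
    by (intro L2_set_mono) (auto intro: norm_triangle_ineq)
  also have "\<dots> \<le> euclidean_norm u + euclidean_norm v"
    using assms by (simp add: euclidean_norm_carrier L2_set_triangle_ineq)
  finally show ?thesis .
qed

lemma euclidean_norm_triangle_diff:
  assumes "u \<in> carrier_vec n" "v \<in> carrier_vec n"
  shows "euclidean_norm u \<le> euclidean_norm v + euclidean_norm (u - v)"
proof -
  have "u = v + (u - v)" using assms by (intro eq_vecI) auto
  then show ?thesis
    using euclidean_norm_add[of v n "u - v"] assms by (metis minus_carrier_vec)
qed

lemma euclidean_norm_minus_commute: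
  "u \<in> carrier_vec n \<Longrightarrow> v \<in> carrier_vec n \<Longrightarrow> euclidean_norm (u - v) = euclidean_norm (v - u)"
  by (auto simp: euclidean_norm_def norm_minus_commute intro!: L2_set_cong)

lemma euclidean_norm_smult: "euclidean_norm (c \<cdot>\<^sub>v v) = cmod c * euclidean_norm v"
  by (auto simp: euclidean_norm_def norm_mult L2_set_right_distrib intro!: L2_set_cong)

lemma euclidean_norm_zero [simp]: "euclidean_norm (0\<^sub>v n) = 0"
  by (simp add: euclidean_norm_def L2_set_def)

lemma euclidean_norm_zero_iff:
  assumes "v \<in> carrier_vec n"
  shows "euclidean_norm v = 0 \<longleftrightarrow> v = 0\<^sub>v n"
proof
  assume "euclidean_norm v = 0"
  then show "v = 0\<^sub>v n"
    using assms by (intro eq_vecI) (auto simp: euclidean_norm_def L2_set_eq_0_iff)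
qed simp

lemma euclidean_norm_sum_le:
  assumes "v \<in> carrier_vec n"
  shows "cmod (\<Sum>i<n. f i * vec_index v i) \<le> L2_set (\<lambda>i. cmod (f i)) {..<n} * euclidean_norm v"
proof -
  have "cmod (\<Sum>i<n. f i * vec_index v i) \<le> (\<Sum>i<n. \<bar>cmod (f i)\<bar> * \<bar>cmod (vec_index v i)\<bar>)"
    by (intro sum_norm_le) (simp add: norm_mult)
  also have "\<dots> \<le> L2_set (\<lambda>i. cmod (f i)) {..<n} * euclidean_norm v"
    unfolding euclidean_norm_carrier[OF assms] by (rule L2_set_mult_ineq)
  finally show ?thesis .
qed

lemma mult_mat_vec_index:
  assumes "M \<in> carrier_mat n m" "v \<in> carrier_vec m" "i < n"
  shows "vec_index (M *\<^sub>v v) i = (\<Sum>j<m. M $$ (i, j) * vec_index v j)"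
  using assms by (auto simp: scalar_prod_def lessThan_atLeast0 intro!: sum.cong)

lemma euclidean_norm_mult_mat_vec_le:
  assumes M: "M \<in> carrier_mat n n" and v: "v \<in> carrier_vec n"
  shows "euclidean_norm (M *\<^sub>v v) \<le> mat_norm M * euclidean_norm v"
proof (cases "euclidean_norm v = 0")
  case True
  then have "M *\<^sub>v v = 0\<^sub>v n"
    using euclidean_norm_zero_iff[OF v] M by (intro eq_vecI) auto
  then show ?thesis using True by simp
next
  case False
  define t where "t = euclidean_norm v"
  have t: "t > 0" using False euclidean_norm_nonneg[of v] by (simp add: t_def)
  define U where "U = {v \<in> carrier_vec n. euclidean_norm v \<le> 1}"
  \<comment> \<open>The supremum in \<open>mat_norm\<close> dominates its members only once the set
    is known to be bounded; the sum of the Euclidean norms of the rows is a crude bound.\<close>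
  have bdd: "bdd_above ((\<lambda>v. euclidean_norm (M *\<^sub>v v)) ` U)"
  proof (rule bdd_aboveI2)
    fix u assume "u \<in> U"
    then have u: "u \<in> carrier_vec n" "euclidean_norm u \<le> 1" by (auto simp: U_def)
    have "euclidean_norm (M *\<^sub>v u) \<le> (\<Sum>i<n. cmod (vec_index (M *\<^sub>v u) i))"
      unfolding euclidean_norm_carrier[OF mult_mat_vec_carrier[OF M u(1)]]
      by (rule L2_set_le_sum) simp
    also have "\<dots> \<le> (\<Sum>i<n. L2_set (\<lambda>j. cmod (M $$ (i, j))) {..<n})"
    proof (rule sum_mono)
      fix i assume "i \<in> {..<n}"
      then have "cmod (vec_index (M *\<^sub>v u) i) \<le> L2_set (\<lambda>j. cmod (M $$ (i, j))) {..<n} * euclidean_norm u"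
        using euclidean_norm_sum_le[OF u(1)] mult_mat_vec_index[OF M u(1), of i] by simp
      also have "\<dots> \<le> L2_set (\<lambda>j. cmod (M $$ (i, j))) {..<n}"
        using u(2) euclidean_norm_nonneg[of u] by (intro mult_right_le_one_le) auto
      finally show "cmod (vec_index (M *\<^sub>v u) i) \<le> L2_set (\<lambda>j. cmod (M $$ (i, j))) {..<n}" .
    qed
    finally show "euclidean_norm (M *\<^sub>v u) \<le> (\<Sum>i<n. L2_set (\<lambda>j. cmod (M $$ (i, j))) {..<n})" .
  qed
  define u where "u = complex_of_real (1 / t) \<cdot>\<^sub>v v"
  have "u \<in> U" using v t by (simp add: U_def u_def euclidean_norm_smult norm_divide t_def[symmetric])
  then have "euclidean_norm (M *\<^sub>v u) \<le> mat_norm M"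
    using M bdd unfolding mat_norm_def U_def by (intro cSUP_upper) auto
  moreover have "M *\<^sub>v u = complex_of_real (1 / t) \<cdot>\<^sub>v (M *\<^sub>v v)"
    unfolding u_def by (rule mult_mat_vec[OF M v])
  ultimately show ?thesis
    using t by (simp add: euclidean_norm_smult norm_divide t_def[symmetric] divide_simps mult.commute)
qed

definition pencil_mat :: "complex mat \<Rightarrow> complex mat \<Rightarrow> complex mat \<Rightarrow> complex \<Rightarrow> complex mat" where
  "pencil_mat M0 M1 M2 z = M0 - (2 * z) \<cdot>\<^sub>m M1 + z\<^sup>2 \<cdot>\<^sub>m M2"

lemma pencil_mat_carrier:
  "M0 \<in> carrier_mat n n \<Longrightarrow> M1 \<in> carrier_mat n n \<Longrightarrow> M2 \<in> carrier_mat n n \<Longrightarrow>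
    pencil_mat M0 M1 M2 z \<in> carrier_mat n n"
  by (simp add: pencil_mat_def)

text \<open>The coefficients 1, \<open>2 * z\<close> and \<open>z\<^sup>2\<close> have absolute
  values adding up to \<open>(1 + cmod z)\<^sup>2\<close>. The dimension does not enter, so one
  \<epsilon> serves all \<open>n\<close>.\<close>

lemma pencil_mat_perturbation:
  assumes M: "M0 \<in> carrier_mat n n" "M1 \<in> carrier_mat n n" "M2 \<in> carrier_mat n n"
    and A: "A0 \<in> carrier_mat n n" "A1 \<in> carrier_mat n n" "A2 \<in> carrier_mat n n"
    and \<epsilon>: "mat_norm (M0 - A0) \<le> \<epsilon>" "mat_norm (M1 - A1) \<le> \<epsilon>" "mat_norm (M2 - A2) \<le> \<epsilon>"
    and v: "v \<in> carrier_vec n"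
  shows "euclidean_norm (pencil_mat M0 M1 M2 z *\<^sub>v v - pencil_mat A0 A1 A2 z *\<^sub>v v)
    \<le> \<epsilon> * (1 + cmod z)\<^sup>2 * euclidean_norm v"
proof -
  let ?D0 = "M0 - A0" and ?D1 = "M1 - A1" and ?D2 = "M2 - A2"
  have D: "?D0 \<in> carrier_mat n n" "?D1 \<in> carrier_mat n n" "?D2 \<in> carrier_mat n n"
    using A M by auto
  have Dv: "?D0 *\<^sub>v v \<in> carrier_vec n" "?D1 *\<^sub>v v \<in> carrier_vec n" "?D2 *\<^sub>v v \<in> carrier_vec n"
    using D v by auto
  have le: "euclidean_norm (E *\<^sub>v v) \<le> \<epsilon> * euclidean_norm v"
    if "E \<in> carrier_mat n n" "mat_norm E \<le> \<epsilon>" for E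
    using euclidean_norm_mult_mat_vec_le[OF that(1) v]
      mult_right_mono[OF that(2) euclidean_norm_nonneg[of v]] by linarith
  have "pencil_mat M0 M1 M2 z *\<^sub>v v - pencil_mat A0 A1 A2 z *\<^sub>v v
      = ?D0 *\<^sub>v v + ((- (2 * z)) \<cdot>\<^sub>v (?D1 *\<^sub>v v) + z\<^sup>2 \<cdot>\<^sub>v (?D2 *\<^sub>v v))" (is "?l = ?r")
  proof (rule eq_vecI)
    show "dim_vec ?l = dim_vec ?r" using M A by (simp add: pencil_mat_def)
    fix i assume "i < dim_vec ?r"
    then have i: "i < n" using M A by simp
    note ix = mult_mat_vec_index[OF _ v i]
    have "vec_index ?l i = (\<Sum>j<n. pencil_mat M0 M1 M2 z $$ (i, j) * vec_index v j)
        - (\<Sum>j<n. pencil_mat A0 A1 A2 z $$ (i, j) * vec_index v j)"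
      using i pencil_mat_carrier[OF M, of z] pencil_mat_carrier[OF A, of z]
      by (simp add: ix del: index_mult_mat_vec)
    also have "\<dots> = (\<Sum>j<n. ?D0 $$ (i, j) * vec_index v j)
        + (- (2 * z) * (\<Sum>j<n. ?D1 $$ (i, j) * vec_index v j)
        + z\<^sup>2 * (\<Sum>j<n. ?D2 $$ (i, j) * vec_index v j))"
      unfolding sum_distrib_left sum.distrib[symmetric] sum_subtractf[symmetric]
      using i M A by (intro sum.cong refl) (simp add: pencil_mat_def algebra_simps)
    also have "\<dots> = vec_index ?r i"
      using i D by (simp add: ix del: index_mult_mat_vec index_minus_mat)
    finally show "vec_index ?l i = vec_index ?r i" .
  qed
  also have "euclidean_norm \<dots> \<le> euclidean_norm (?D0 *\<^sub>v v)
      + (euclidean_norm ((- (2 * z)) \<cdot>\<^sub>v (?D1 *\<^sub>v v)) + euclidean_norm (z\<^sup>2 \<cdot>\<^sub>v (?D2 *\<^sub>v v)))"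
    using Dv by (intro order_trans[OF euclidean_norm_add[of _ n]] add_mono order_refl) auto
  also have "\<dots> \<le> \<epsilon> * euclidean_norm v + (2 * cmod z * (\<epsilon> * euclidean_norm v)
      + (cmod z)\<^sup>2 * (\<epsilon> * euclidean_norm v))"
    unfolding euclidean_norm_smult
    using le[OF D(1) \<epsilon>(1)] mult_left_mono[OF le[OF D(2) \<epsilon>(2)], of "2 * cmod z"]
      mult_left_mono[OF le[OF D(3) \<epsilon>(3)], of "(cmod z)\<^sup>2"]
    by (simp add: norm_mult norm_power)
  also have "\<dots> = \<epsilon> * (1 + cmod z)\<^sup>2 * euclidean_norm v"
    by (simp add: power2_eq_square algebra_simps)
  finally show ?thesis .
qed

lemma pencil_det_nonzero:
  assumes "M0 \<in> carrier_mat n n" "M1 \<in> carrier_mat n n" "M2 \<in> carrier_mat n n"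
    and "c > 0" "\<And>v. v \<in> carrier_vec n \<Longrightarrow> c * euclidean_norm v \<le> euclidean_norm (pencil_mat M0 M1 M2 z *\<^sub>v v)"
  shows "pencil_det M0 M1 M2 z \<noteq> 0"
proof
  assume "pencil_det M0 M1 M2 z = 0"
  then have "Determinant.det (pencil_mat M0 M1 M2 z) = 0"
    by (simp add: pencil_det_def pencil_mat_def)
  then obtain v where v: "v \<in> carrier_vec n" "v \<noteq> 0\<^sub>v n" "pencil_mat M0 M1 M2 z *\<^sub>v v = 0\<^sub>v n"
    using det_0_iff_vec_prod_zero_field[OF pencil_mat_carrier[OF assms(1-3)]] by blast
  have "c * euclidean_norm v \<le> euclidean_norm (0\<^sub>v n)" using assms(5)[OF v(1)] v(3) by simp
  also have "\<dots> = 0" by simp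
  finally have "euclidean_norm v = 0"
    using \<open>c > 0\<close> euclidean_norm_nonneg[of v] by (simp add: mult_le_0_iff)
  then show False using v euclidean_norm_zero_iff by blast
qed

section \<open>Holomorphic matrix families and zeros of their determinants\<close>

lemma holomorphic_det:
  assumes "\<And>z. F z \<in> carrier_mat n n"
    and "\<And>i j. i < n \<Longrightarrow> j < n \<Longrightarrow> (\<lambda>z. F z $$ (i, j)) holomorphic_on S"
  shows "(\<lambda>z. Determinant.det (F z)) holomorphic_on S"
  unfolding det_def'[OF assms(1)]
proof (intro holomorphic_intros assms(2))
  fix p i assume "p \<in> {p. p permutes {0..<n}}" "i \<in> {0..<n}"
  then have "p i \<in> {0..<n}" by (simp add: permutes_in_image)
  then show "p i < n" by simp
  show "i < n" using \<open>i \<in> {0..<n}\<close> by simp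
qed

text \<open>Cofactors are signed determinants of minors. Dividing the adjugate by the determinant
  then shows that the inverse is holomorphic wherever the determinant does not vanish.\<close>

lemma holomorphic_adj_mat:
  assumes F: "\<And>z. F z \<in> carrier_mat n n"
    and hol: "\<And>i j. i < n \<Longrightarrow> j < n \<Longrightarrow> (\<lambda>z. F z $$ (i, j)) holomorphic_on S"
    and ij: "i < n" "j < n"
  shows "(\<lambda>z. adj_mat (F z) $$ (i, j)) holomorphic_on S"
proof -
  have dims: "dim_row (F z) = n" "dim_col (F z) = n" for z using F[of z] by auto
  have "(\<lambda>z. Determinant.det (mat_delete (F z) j i)) holomorphic_on S"
  proof (rule holomorphic_det)
    show "mat_delete (F z) j i \<in> carrier_mat (n - 1) (n - 1)" for z
      by (rule mat_delete_carrier[OF F])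
    fix i' j' assume "i' < n - 1" "j' < n - 1"
    then show "(\<lambda>z. mat_delete (F z) j i $$ (i', j')) holomorphic_on S"
      by (auto simp: mat_delete_def dims intro!: hol)
  qed
  then show ?thesis
    using ij by (simp add: adj_mat_def dims cofactor_def holomorphic_on_mult)
qed

text \<open>If the determinant had no zero in the disk, the maximum modulus principle would bound the
  inverse of the pencil at the centre by \<open>1 / c\<close>, contradicting the almost null vector there.\<close>

lemma pencil_det_zero_in_ball:
  assumes M: "M0 \<in> carrier_mat n n" "M1 \<in> carrier_mat n n" "M2 \<in> carrier_mat n n"
    and "r > 0" "c > 0"
    and sphere: "\<And>z v. cmod (z - l) = r \<Longrightarrow> v \<in> carrier_vec n \<Longrightarrow>
      c * euclidean_norm v \<le> euclidean_norm (pencil_mat M0 M1 M2 z *\<^sub>v v)"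
    and v: "v \<in> carrier_vec n" "euclidean_norm (pencil_mat M0 M1 M2 l *\<^sub>v v) < c * euclidean_norm v"
  shows "\<exists>\<zeta>. pencil_det M0 M1 M2 \<zeta> = 0 \<and> cmod (\<zeta> - l) < r"
proof (rule ccontr)
  assume no_zero: "\<nexists>\<zeta>. pencil_det M0 M1 M2 \<zeta> = 0 \<and> cmod (\<zeta> - l) < r"
  define P where "P = pencil_mat M0 M1 M2"
  have P: "P z \<in> carrier_mat n n" for z unfolding P_def by (rule pencil_mat_carrier[OF M])
  have det: "Determinant.det (P z) = pencil_det M0 M1 M2 z" for z
    by (simp add: P_def pencil_det_def pencil_mat_def)
  have nz: "Determinant.det (P z) \<noteq> 0" if "z \<in> cball l r" for z
  proof (cases "cmod (z - l) = r")
    case True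
    then show ?thesis unfolding det by (intro pencil_det_nonzero[OF M \<open>c > 0\<close>] sphere)
  next
    case False
    then have "cmod (z - l) < r" using that by (simp add: dist_norm norm_minus_commute)
    then show ?thesis using no_zero det by auto
  qed
  define a where "a = P l *\<^sub>v v"
  \<comment> \<open>This is the inverse of \<open>P z\<close> applied to \<open>a\<close>. Division
    by a vanishing determinant yields 0, but only points of the closed disk are used, where the
    determinant is nonzero.\<close>
  define x where "x z = (1 / Determinant.det (P z)) \<cdot>\<^sub>v (adj_mat (P z) *\<^sub>v a)" for z
  have a: "a \<in> carrier_vec n" unfolding a_def using P v(1) by (rule mult_mat_vec_carrier)
  have adj: "adj_mat (P z) \<in> carrier_mat n n" for z by (rule adj_mat(1)[OF P])
  have x: "x z \<in> carrier_vec n" for z unfolding x_def by (simp add: mult_mat_vec_carrier[OF adj a])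
  have scal: "(d \<cdot>\<^sub>m 1\<^sub>m n) *\<^sub>v w = d \<cdot>\<^sub>v w" if "w \<in> carrier_vec n" for d :: complex and w
    using that by (intro eq_vecI) (auto simp: mult_mat_vec_index scalar_prod_def if_distrib
        if_distribR sum.delta cong: if_cong)
  have Px: "P z *\<^sub>v x z = a" if "z \<in> cball l r" for z
  proof -
    have "P z *\<^sub>v x z = (1 / Determinant.det (P z)) \<cdot>\<^sub>v ((P z * adj_mat (P z)) *\<^sub>v a)"
      unfolding x_def mult_mat_vec[OF P mult_mat_vec_carrier[OF adj a]] assoc_mult_mat_vec[OF P adj a] ..
    also have "\<dots> = a"
      unfolding adj_mat(2)[OF P] scal[OF a] using nz[OF that] a by (simp add: smult_smult_assoc)
    finally show ?thesis .
  qed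
  have xl: "x l = v"
  proof -
    have "adj_mat (P l) *\<^sub>v a = (adj_mat (P l) * P l) *\<^sub>v v"
      unfolding a_def assoc_mult_mat_vec[OF adj P v(1)] ..
    then show ?thesis
      unfolding x_def adj_mat(3)[OF P] scal[OF v(1)] using nz[of l] \<open>r > 0\<close> v
      by (simp add: smult_smult_assoc)
  qed
  \<comment> \<open>Pairing with \<open>v\<close> reduces the maximum principle to a scalar
    function. Its value at the centre is the squared norm of \<open>v\<close>, while on the circle
    it is at most \<open>t * (euclidean_norm a / c)\<close>, which is smaller.\<close>
  define f where "f z = (\<Sum>k<n. cnj (vec_index v k) * vec_index (x z) k)" for z
  have hol_entry: "(\<lambda>z. P z $$ (i, j)) holomorphic_on cball l r" if "i < n" "j < n" for i j
    using that M by (auto simp: P_def pencil_mat_def intro!: holomorphic_intros)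
  have "(\<lambda>z. vec_index (x z) k) holomorphic_on cball l r" if k: "k < n" for k
  proof -
    have "vec_index (x z) k = (\<Sum>j<n. adj_mat (P z) $$ (k, j) * vec_index a j) / Determinant.det (P z)" for z
      using k adj[of z] a by (simp add: x_def mult_mat_vec_index[OF adj a k] del: index_mult_mat_vec)
    moreover have "(\<lambda>z. (\<Sum>j<n. adj_mat (P z) $$ (k, j) * vec_index a j) / Determinant.det (P z))
        holomorphic_on cball l r"
      using k by (intro holomorphic_on_divide holomorphic_on_sum holomorphic_on_mult
          holomorphic_on_const holomorphic_adj_mat[OF P hol_entry] holomorphic_det[OF P hol_entry] nz) auto
    ultimately show ?thesis by presburger
  qed
  then have hol: "f holomorphic_on cball l r"
    unfolding f_def by (intro holomorphic_intros) auto
  define t where "t = euclidean_norm v"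
  have t: "t \<ge> 0" unfolding t_def by (rule euclidean_norm_nonneg)
  have norm_conj: "L2_set (\<lambda>k. cmod (cnj (vec_index v k))) {..<n} = t"
    using v by (simp add: t_def euclidean_norm_carrier)
  have "cmod (f l) \<le> t * (euclidean_norm a / c)"
  proof (rule maximum_modulus_frontier[of f "cball l r"])
    show "f holomorphic_on interior (cball l r)"
      using hol holomorphic_on_subset interior_subset by blast
    show "continuous_on (closure (cball l r)) f"
      using holomorphic_on_imp_continuous_on[OF hol] by simp
    show "l \<in> cball l r" using \<open>r > 0\<close> by simp
    fix z assume "z \<in> frontier (cball l r)"
    then have z: "cmod (z - l) = r" using \<open>r > 0\<close> by (simp add: dist_norm norm_minus_commute)
    have zb: "z \<in> cball l r" using z by (simp add: dist_norm norm_minus_commute)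
    have "c * euclidean_norm (x z) \<le> euclidean_norm a"
      using sphere[OF z x[of z]] Px[OF zb] by (simp add: P_def)
    then have "euclidean_norm (x z) \<le> euclidean_norm a / c" using \<open>c > 0\<close> by (simp add: field_simps)
    then have "t * euclidean_norm (x z) \<le> t * (euclidean_norm a / c)" using t by (rule mult_left_mono)
    then show "cmod (f z) \<le> t * (euclidean_norm a / c)"
      using euclidean_norm_sum_le[OF x[of z], of "\<lambda>k. cnj (vec_index v k)"]
      unfolding f_def norm_conj by linarith
  qed simp_all
  moreover have "f l = complex_of_real (t\<^sup>2)"
  proof -
    have "f l = (\<Sum>k<n. complex_of_real ((cmod (vec_index v k))\<^sup>2))"
      unfolding f_def xl by (intro sum.cong refl) (simp add: complex_norm_square mult.commute del: of_real_power)
    also have "\<dots> = complex_of_real (t\<^sup>2)"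
      using v by (simp add: t_def euclidean_norm_carrier L2_set_def sum_nonneg)
    finally show ?thesis .
  qed
  moreover have lt: "euclidean_norm a < c * t" using v(2) by (simp add: a_def P_def t_def)
  moreover have "t > 0"
  proof (rule ccontr)
    assume "\<not> t > 0"
    then have "t = 0" using t by simp
    then show False using lt euclidean_norm_nonneg[of a] by simp
  qed
  ultimately have "t * t \<le> t * (euclidean_norm a / c)" by (simp add: norm_mult power2_eq_square)
  then have "t \<le> euclidean_norm a / c" using \<open>t > 0\<close> by (rule mult_left_le_imp_le)
  then show False using lt \<open>c > 0\<close> by (simp add: field_simps)
qed

subsection \<open>Coordinates in the trial spaces\<close>

lemma orthonormal_basis_props:
  assumes "orthonormal_basis n b V"
  shows orthonormal_basis_set: "orthonormal_set (b ` {..<n})"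
    and orthonormal_basis_span: "cspan (b ` {..<n}) = V"
    and orthonormal_basis_proj: "orth_proj V x = (\<Sum>j<n. cinner x (b j) *\<^sub>C b j)"
    and orthonormal_basis_norm: "norm (\<Sum>j<n. a j *\<^sub>C b j) = L2_set (\<lambda>j. cmod (a j)) {..<n}"
proof -
  have on: "cinner (b j) (b k) = (if j = k then 1 else 0)" if "j < n" "k < n" for j k
    using assms that by (simp add: orthonormal_basis_def)
  \<comment> \<open>Injectivity allows sums over the set of basis vectors to be rewritten as sums
    over indices.\<close>
  have inj: "inj_on b {..<n}"
  proof (rule inj_onI)
    fix j k assume "j \<in> {..<n}" "k \<in> {..<n}" "b j = b k"
    then show "j = k" using on[of j k] on[of k k] by (auto split: if_splits)
  qed
  show os: "orthonormal_set (b ` {..<n})"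
    using on inj by (auto simp: orthonormal_set_def inj_on_def)
  show span: "cspan (b ` {..<n}) = V"
    using assms by (simp add: orthonormal_basis_def)
  show "orth_proj V x = (\<Sum>j<n. cinner x (b j) *\<^sub>C b j)"
    unfolding span[symmetric] orth_proj_cspan[OF os] by (simp add: sum.reindex[OF inj])
  let ?x = "\<Sum>j<n. a j *\<^sub>C b j"
  have "cinner (b j) ?x = cnj (a j)" if "j < n" for j
  proof -
    have "cinner (b j) ?x = (\<Sum>k<n. if j = k then cnj (a k) else 0)"
      unfolding cinner_sum_right cinner_scaleC_right using that by (intro sum.cong) (auto simp: on)
    then show ?thesis using that by simp
  qed
  then have "cinner ?x ?x = (\<Sum>j<n. a j * cnj (a j))"
    by (subst cinner_sum_left) (simp add: cinner_scaleC_left)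
  also have "\<dots> = complex_of_real (\<Sum>j<n. (cmod (a j))\<^sup>2)"
    by (simp only: of_real_sum complex_norm_square)
  finally have "(norm ?x)\<^sup>2 = (\<Sum>j<n. (cmod (a j))\<^sup>2)"
    unfolding cinner_self using of_real_eq_iff by blast
  then show "norm ?x = L2_set (\<lambda>j. cmod (a j)) {..<n}"
    unfolding L2_set_def by (metis norm_ge_zero real_sqrt_unique)
qed

lemma pencil_form_sum:
  assumes "linear_operator D B" "\<And>i. i \<in> I \<Longrightarrow> f i \<in> D"
  shows pencil_form_sum_left: "pencil_form B s (\<Sum>i\<in>I. a i *\<^sub>C f i) x = (\<Sum>i\<in>I. a i * pencil_form B s (f i) x)"
    and pencil_form_sum_right: "pencil_form B s x (\<Sum>i\<in>I. a i *\<^sub>C f i) = (\<Sum>i\<in>I. cnj (a i) * pencil_form B s x (f i))"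
proof -
  \<comment> \<open>Membership of the partial sums in \<open>D\<close> is carried through the
    induction, because additivity of the form requires it.\<close>
  have "(\<Sum>i\<in>I. a i *\<^sub>C f i) \<in> D \<and>
    pencil_form B s (\<Sum>i\<in>I. a i *\<^sub>C f i) x = (\<Sum>i\<in>I. a i * pencil_form B s (f i) x) \<and>
    pencil_form B s x (\<Sum>i\<in>I. a i *\<^sub>C f i) = (\<Sum>i\<in>I. cnj (a i) * pencil_form B s x (f i))"
    using assms(2)
  proof (induction I rule: infinite_finite_induct)
    case (insert i I)
    note lins = linear_operatorD[OF assms(1)]
    have mem: "a i *\<^sub>C f i \<in> D" "f i \<in> D" using insert by (auto simp: lins)
    have IH: "(\<Sum>i\<in>I. a i *\<^sub>C f i) \<in> D"
      "pencil_form B s (\<Sum>i\<in>I. a i *\<^sub>C f i) x = (\<Sum>i\<in>I. a i * pencil_form B s (f i) x)"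
      "pencil_form B s x (\<Sum>i\<in>I. a i *\<^sub>C f i) = (\<Sum>i\<in>I. cnj (a i) * pencil_form B s x (f i))"
      using insert by auto
    show ?case
      using insert(1,2) mem IH
      by (simp add: lins(2) pencil_form_add_left[OF assms(1) mem(1) IH(1)]
          pencil_form_add_right[OF assms(1) mem(1) IH(1)]
          pencil_form_scale_left[OF assms(1) mem(2) mem(2)]
          pencil_form_scale_right[OF assms(1) mem(2) mem(2)])
  qed (simp_all add: linear_operatorD[OF assms(1)] pencil_form_def)
  then show "pencil_form B s (\<Sum>i\<in>I. a i *\<^sub>C f i) x = (\<Sum>i\<in>I. a i * pencil_form B s (f i) x)"
    "pencil_form B s x (\<Sum>i\<in>I. a i *\<^sub>C f i) = (\<Sum>i\<in>I. cnj (a i) * pencil_form B s x (f i))"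
    by auto
qed

text \<open>The form pairs \<open>(B - s) u\<close> with \<open>(B - cnj s) w\<close>. For real
  \<open>l\<close>, \<open>B = A - l\<close> and \<open>s = z - l\<close>, these operators are
  \<open>A - z\<close> and \<open>A - cnj z\<close>, so \<open>l\<close> drops out.\<close>

lemma pencil_form_shift:
  assumes "self_adjoint D A" "u \<in> D" "w \<in> D" "cnj l = l"
  shows "pencil_form (\<lambda>u. A u - l *\<^sub>C u) (z - l) u w
    = cinner (A u) (A w) - 2 * z * cinner (A u) w + z\<^sup>2 * cinner u w"
  by (simp add: pencil_form_def cinner_simps assms(4) self_adjoint_symmetric[OF assms(1-3), symmetric]
      power2_eq_square algebra_simps)

text \<open>The first index of the pencil matrices belongs to the linear argument of the inner product;
  hence the conjugates.\<close>

lemma pencil_mat_mult_vec: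
  assumes sa: "self_adjoint D A" and l: "cnj l = l"
    and e: "\<And>j. j < n \<Longrightarrow> e n j \<in> D" and v: "v \<in> carrier_vec n" and i: "i < n"
  shows "vec_index (pencil_mat (mat_A0 A e n) (mat_A1 A e n) (mat_A2 e n) z *\<^sub>v v) i
    = pencil_form (\<lambda>u. A u - l *\<^sub>C u) (z - l) (e n i) (\<Sum>k<n. cnj (vec_index v k) *\<^sub>C e n k)"
proof -
  let ?B = "\<lambda>u. A u - l *\<^sub>C u"
  note lin = self_adjoint_linear[OF self_adjoint_shift_real[OF sa l]]
  have "pencil_mat (mat_A0 A e n) (mat_A1 A e n) (mat_A2 e n) z \<in> carrier_mat n n"
    by (rule pencil_mat_carrier) (simp_all add: mat_A0_def mat_A1_def mat_A2_def)
  then have "vec_index (pencil_mat (mat_A0 A e n) (mat_A1 A e n) (mat_A2 e n) z *\<^sub>v v) i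
      = (\<Sum>k<n. pencil_mat (mat_A0 A e n) (mat_A1 A e n) (mat_A2 e n) z $$ (i, k) * vec_index v k)"
    by (rule mult_mat_vec_index[OF _ v i])
  also have "\<dots> = (\<Sum>k<n. cnj (cnj (vec_index v k)) * pencil_form ?B (z - l) (e n i) (e n k))"
    using i e by (intro sum.cong refl)
      (simp add: pencil_mat_def mat_A0_def mat_A1_def mat_A2_def pencil_form_shift[OF sa _ _ l])
  also have "\<dots> = pencil_form ?B (z - l) (e n i) (\<Sum>k<n. cnj (vec_index v k) *\<^sub>C e n k)"
    using e by (intro pencil_form_sum_right[OF lin, symmetric]) simp
  finally show ?thesis .
qed

lemma self_adjoint_eigenvalue_real:
  assumes "self_adjoint D A" "u \<in> eigenspace D A l" "u \<noteq> 0"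
  shows "cnj l = l"
proof -
  have u: "u \<in> D" "A u = l *\<^sub>C u" using assms(2) by (auto simp: eigenspace_def)
  have "l * cinner u u = cnj l * cinner u u"
    using self_adjoint_symmetric[OF assms(1) u(1) u(1)] u(2) by (simp add: cinner_simps)
  then show ?thesis using \<open>u \<noteq> 0\<close> by (simp add: cinner_self)
qed

text \<open>The second sum is the vector of the trial space that represents the functional pairing
  \<open>B (orth_proj (L n) u)\<close> with \<open>B w\<close>. Its bound is quadratic in \<rho>
  because the norm of \<open>B (orth_proj (L n) u)\<close> will be obtained from it through a square
  root.\<close>

lemma condition_H_uniform:
  fixes A :: "'a::complex_hilbert \<Rightarrow> 'a"
  assumes sa: "self_adjoint D A" and l: "cnj l = l"
    and C: "orthonormal_set C" "eigenspace D A l = cspan C"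
    and LD: "\<And>n. n \<ge> 1 \<Longrightarrow> L n \<subseteq> D" and basis: "\<And>n. n \<ge> 1 \<Longrightarrow> orthonormal_basis n (e n) (L n)"
    and H: "condition_H D A L e l" and \<rho>: "\<rho> > 0"
  defines "B \<equiv> \<lambda>u. A u - l *\<^sub>C u"
  shows "\<exists>N\<ge>1. \<forall>n>N. \<forall>u\<in>cspan C.
    norm (orth_proj (L n) u - u) \<le> \<rho> * norm u \<and>
    norm (\<Sum>j<n. cinner (B (orth_proj (L n) u)) (B (e n j)) *\<^sub>C e n j) \<le> \<rho>\<^sup>2 * norm u"
proof -
  let ?P = "\<lambda>n. orth_proj (L n)"
  note lin = self_adjoint_linear[OF self_adjoint_shift_real[OF sa l], folded B_def]
  note os = orthonormal_basis_set[OF basis] and span = orthonormal_basis_span[OF basis]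
    and proj = orthonormal_basis_proj[OF basis]
  have P_add: "?P n (u + v) = ?P n u + ?P n v" and P_scale: "?P n (a *\<^sub>C u) = a *\<^sub>C ?P n u"
    and P_in: "?P n u \<in> D" and P_idem: "?P n (?P n u) = ?P n u" if "n \<ge> 1" for n u v a
    using orth_proj_add[OF os[OF that]] orth_proj_scale[OF os[OF that]] orth_proj_in[OF os[OF that]]
      orth_proj_ident[OF os[OF that] orth_proj_in[OF os[OF that]]] LD[OF that]
    unfolding span[OF that] by auto
  define S where "S p q n u = (\<Sum>j<n. cinner ((A ^^ p) (?P n u)) ((A ^^ q) (e n j)) *\<^sub>C e n j)"
    for p q :: nat and n u
  define G where "G n u = ?P n u - u" for n u
  define R where "R n u = (\<Sum>j<n. cinner (B (?P n u)) (B (e n j)) *\<^sub>C e n j)" for n u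
  have null: "(\<lambda>n. norm (S p q n u - l ^ (p + q) *\<^sub>C u)) \<longlonglongrightarrow> 0"
    if "p \<in> {0, 1}" "q \<in> {0, 1}" "u \<in> cspan C" for p q u
    using H that unfolding condition_H_def S_def C(2)[symmetric] eigenspace_def by blast
  have CE: "c \<in> cspan C" if "c \<in> C" for c using that by (rule complex_vector.span_base)
  \<comment> \<open>With both exponents 0 the sum in condition (H) is the projection of an already
    projected vector.\<close>
  have G_null: "(\<lambda>n. norm (G n c)) \<longlonglongrightarrow> 0" if "c \<in> C" for c
  proof (rule Lim_transform_eventually[OF null[OF _ _ CE[OF that], of 0 0]])
    show "\<forall>\<^sub>F n in sequentially. norm (S 0 0 n c - l ^ (0 + 0) *\<^sub>C c) = norm (G n c)"
      using eventually_ge_at_top[of 1]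
    proof eventually_elim
      case (elim n)
      then have "S 0 0 n c = ?P n c"
        using proj[of n "?P n c"] P_idem[of n c] by (simp add: S_def)
      then show ?case by (simp add: G_def scaleC_one)
    qed
  qed simp_all
  have R_null: "(\<lambda>n. norm (R n c)) \<longlonglongrightarrow> 0" if "c \<in> C" for c
  proof (rule Lim_null_comparison)
    \<comment> \<open>Expanding both occurrences of \<open>B = A - l\<close> combines the four cases
      with coefficients 1, \<open>- l\<close>, \<open>- l\<close>, \<open>l\<^sup>2\<close>, where
      \<open>l\<close> leaves the second argument unconjugated since it is real. The limits then
      cancel.\<close>
    have R_eq: "R n c = (S 1 1 n c - l ^ (1 + 1) *\<^sub>C c) - l *\<^sub>C (S 1 0 n c - l ^ (1 + 0) *\<^sub>C c)
        - l *\<^sub>C (S 0 1 n c - l ^ (0 + 1) *\<^sub>C c) + l\<^sup>2 *\<^sub>C (S 0 0 n c - l ^ (0 + 0) *\<^sub>C c)" for n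
      unfolding R_def S_def B_def
      by (simp add: cinner_simps l complex_vector.scale_sum_right complex_vector.scale_left_diff_distrib
          complex_vector.scale_right_diff_distrib scaleC_add_left scaleC_scaleC scaleC_one
          sum.distrib sum_subtractf power2_eq_square algebra_simps)
    show "\<forall>\<^sub>F n in sequentially. norm (norm (R n c)) \<le> norm (S 1 1 n c - l ^ (1 + 1) *\<^sub>C c)
        + cmod l * norm (S 1 0 n c - l ^ (1 + 0) *\<^sub>C c) + cmod l * norm (S 0 1 n c - l ^ (0 + 1) *\<^sub>C c)
        + (cmod l)\<^sup>2 * norm (S 0 0 n c - l ^ (0 + 0) *\<^sub>C c)"
      unfolding R_eq real_norm_def abs_norm_cancel
      by (rule always_eventually, rule allI, rule order_trans[OF norm_triangle_ineq], rule add_mono,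
          rule order_trans[OF norm_triangle_ineq4], rule add_mono, rule order_trans[OF norm_triangle_ineq4])
        (simp_all add: norm_scaleC norm_power)
    have "(\<lambda>n. norm (S 1 1 n c - l ^ (1 + 1) *\<^sub>C c)
        + cmod l * norm (S 1 0 n c - l ^ (1 + 0) *\<^sub>C c) + cmod l * norm (S 0 1 n c - l ^ (0 + 1) *\<^sub>C c)
        + (cmod l)\<^sup>2 * norm (S 0 0 n c - l ^ (0 + 0) *\<^sub>C c))
        \<longlonglongrightarrow> 0 + cmod l * 0 + cmod l * 0 + (cmod l)\<^sup>2 * 0"
      by (intro tendsto_intros null CE[OF that]) auto
    then show "(\<lambda>n. norm (S 1 1 n c - l ^ (1 + 1) *\<^sub>C c)
        + cmod l * norm (S 1 0 n c - l ^ (1 + 0) *\<^sub>C c) + cmod l * norm (S 0 1 n c - l ^ (0 + 1) *\<^sub>C c)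
        + (cmod l)\<^sup>2 * norm (S 0 0 n c - l ^ (0 + 0) *\<^sub>C c)) \<longlonglongrightarrow> 0"
      by simp
  qed
  obtain N1 where N1: "\<And>n u. n > N1 \<Longrightarrow> u \<in> cspan C \<Longrightarrow> norm (G n u) \<le> \<rho> * norm u"
    using uniform_null_on_cspan[OF C(1) _ _ G_null \<rho>, of 1]
    by (force simp: G_def P_add P_scale complex_vector.scale_right_diff_distrib)
  have R_add: "R n (u + v) = R n u + R n v" and R_scale: "R n (a *\<^sub>C u) = a *\<^sub>C R n u"
    if "n \<ge> 1" for n u v a
    by (simp_all add: R_def P_add[OF that] P_scale[OF that] P_in[OF that] linear_operatorD(5,6)[OF lin]
        cinner_simps scaleC_add_left sum.distrib complex_vector.scale_sum_right)
  obtain N2 where N2: "\<And>n u. n > N2 \<Longrightarrow> u \<in> cspan C \<Longrightarrow> norm (R n u) \<le> \<rho>\<^sup>2 * norm u"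
    using uniform_null_on_cspan[OF C(1) R_add R_scale R_null, of 1 "\<rho>\<^sup>2"] \<rho> by auto
  show ?thesis
    using N1 N2 by (intro exI[of _ "max 1 (max N1 N2)"]) (auto simp: G_def R_def)
qed

text \<open>In coordinates the form at \<open>w\<close> and \<open>x\<close> is the sum of the
  coefficients of \<open>w\<close> times the entries of the matrix-vector product, so it is at most
  \<open>norm w\<close> times the norm of that product. The loss of 3 is the allowed length of the
  test vector.\<close>

lemma pencil_mat_lower_bound:
  fixes A :: "'a::complex_hilbert \<Rightarrow> 'a"
  assumes sa: "self_adjoint D A" and l: "cnj l = l"
    and basis: "orthonormal_basis n (e n) V" and VD: "V \<subseteq> D"
    and v: "v \<in> carrier_vec n" and x: "x = (\<Sum>k<n. cnj (vec_index v k) *\<^sub>C e n k)"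
    and w: "w \<in> V" "norm w \<le> 3 * norm x"
    and le: "a * (norm x)\<^sup>2 \<le> cmod (pencil_form (\<lambda>u. A u - l *\<^sub>C u) (z - l) w x)"
  shows "a / 3 * euclidean_norm v
    \<le> euclidean_norm (pencil_mat (mat_A0 A e n) (mat_A1 A e n) (mat_A2 e n) z *\<^sub>v v)"
proof -
  let ?B = "\<lambda>u. A u - l *\<^sub>C u" and ?T = "pencil_mat (mat_A0 A e n) (mat_A1 A e n) (mat_A2 e n) z"
  note lin = self_adjoint_linear[OF self_adjoint_shift_real[OF sa l]]
  note span = orthonormal_basis_span[OF basis]
  have eD: "e n j \<in> D" if "j < n" for j
    using that VD complex_vector.span_base[of "e n j" "e n ` {..<n}"] span by auto
  have Tv: "?T *\<^sub>v v \<in> carrier_vec n"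
    by (rule mult_mat_vec_carrier[OF pencil_mat_carrier v]) (simp_all add: mat_A0_def mat_A1_def mat_A2_def)
  have nx: "norm x = euclidean_norm v"
    unfolding x orthonormal_basis_norm[OF basis] euclidean_norm_carrier[OF v] by simp
  have wE: "w = (\<Sum>j<n. cinner w (e n j) *\<^sub>C e n j)"
    using orth_proj_ident[OF orthonormal_basis_set[OF basis]] w(1)
    unfolding span orthonormal_basis_proj[OF basis] by metis
  have nw: "L2_set (\<lambda>j. cmod (cinner w (e n j))) {..<n} = norm w"
    using orthonormal_basis_norm[OF basis, of "\<lambda>j. cinner w (e n j)"] wE by simp
  have "pencil_form ?B (z - l) w x = (\<Sum>j<n. cinner w (e n j) * pencil_form ?B (z - l) (e n j) x)"
    by (subst wE, rule pencil_form_sum_left[OF lin]) (use eD in auto)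
  also have "\<dots> = (\<Sum>j<n. cinner w (e n j) * vec_index (?T *\<^sub>v v) j)"
    by (intro sum.cong refl) (simp add: pencil_mat_mult_vec[where e = e, OF sa l eD v] x del: index_mult_mat_vec)
  finally have "cmod (pencil_form ?B (z - l) w x) \<le> norm w * euclidean_norm (?T *\<^sub>v v)"
    using euclidean_norm_sum_le[OF Tv, of "\<lambda>j. cinner w (e n j)"] by (simp only: nw)
  also have "\<dots> \<le> 3 * norm x * euclidean_norm (?T *\<^sub>v v)"
    using w(2) by (intro mult_right_mono euclidean_norm_nonneg)
  finally have *: "norm x * (a / 3 * norm x) \<le> norm x * euclidean_norm (?T *\<^sub>v v)"
    using le by (simp add: power2_eq_square algebra_simps)
  show ?thesis
  proof (cases "norm x = 0")
    case True
    then show ?thesis using euclidean_norm_nonneg nx by simp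
  next
    case False
    then have "0 < norm x" by simp
    from mult_left_le_imp_le[OF * this] show ?thesis by (simp only: nx)
  qed
qed

theorem theorem5:
  fixes D :: "'a::complex_hilbert set" and A :: "'a \<Rightarrow> 'a" and l :: complex
    and L :: "nat \<Rightarrow> 'a set" and e :: "nat \<Rightarrow> nat \<Rightarrow> 'a" and d \<delta> :: real
  assumes "\<not> finite_dimensional (UNIV :: 'a set)"
    and "self_adjoint D A"
    and "l \<in> Spec_disc D A"
    and "d = infdist l (Spec D A - {l})"
    and "\<And>n. n \<ge> 1 \<Longrightarrow> csubspace (L n) \<and> L n \<subseteq> D \<and> cdim (L n) = n"
    and "\<And>n. n \<ge> 1 \<Longrightarrow> orthonormal_basis n (e n) (L n)"
    and "condition_H D A L e l"
    and "0 < \<delta>" and "\<delta> < d / 4"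
  shows "\<exists>N::nat. \<exists>\<epsilon>0 \<epsilon>1 \<epsilon>2 :: real. N > 0 \<and> \<epsilon>0 > 0 \<and> \<epsilon>1 > 0 \<and> \<epsilon>2 > 0 \<and>
    (\<forall>n>N. \<forall>M0\<in>carrier_mat n n. \<forall>M1\<in>carrier_mat n n. \<forall>M2\<in>carrier_mat n n.
      mat_norm (M0 - mat_A0 A e n) < \<epsilon>0 \<and> mat_norm (M1 - mat_A1 A e n) < \<epsilon>1 \<and>
      mat_norm (M2 - mat_A2 e n) < \<epsilon>2 \<longrightarrow>
        (\<exists>\<zeta>. pencil_det M0 M1 M2 \<zeta> = 0 \<and> cmod (\<zeta> - l) < \<delta>) \<and>
        {\<mu>. pencil_det M0 M1 M2 \<mu> = 0} \<inter> {w. \<delta> < cmod (w - l) \<and> cmod (w - l) \<le> d / 4} = {})"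
proof -
  note sa = assms(2) and basis = assms(6)
  have LD: "L n \<subseteq> D" if "n \<ge> 1" for n using assms(5)[OF that] by blast
  have d: "d > 0" using assms(8,9) by linarith
  obtain u where u: "u \<in> eigenspace D A l" "u \<noteq> 0"
    using assms(3) by (auto simp: Spec_disc_def)
  note l = self_adjoint_eigenvalue_real[OF sa u]
  define B where "B = (\<lambda>u. A u - l *\<^sub>C u)"
  have saB: "self_adjoint D B"
    unfolding B_def by (rule self_adjoint_shift_real[OF sa l])
  note lins = linear_operatorD[OF self_adjoint_linear[OF saB]]
  have EB: "eigenspace D B 0 = eigenspace D A l"
    by (auto simp: eigenspace_def B_def)
  have "csubspace (eigenspace D B 0)"
    by (rule complex_vector.subspaceI) (auto simp: eigenspace_def lins)
  moreover have "finite_dimensional (eigenspace D B 0)"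
    using assms(3) by (simp add: EB Spec_disc_def)
  ultimately obtain C where C: "orthonormal_set C" "eigenspace D B 0 = cspan C"
    using finite_dimensional_orthonormal by metis
  have gap: "d * norm q \<le> norm (B q)"
    if "q \<in> D" "\<And>k. k \<in> eigenspace D B 0 \<Longrightarrow> cinner q k = 0" for q
  proof (rule spectral_gap[OF saB d _ that])
    fix t :: real assume t: "0 < \<bar>t\<bar>" "\<bar>t\<bar> < d"
    have "complex_of_real t + l \<in> resolvent_set D A"
    proof (rule ccontr)
      assume "complex_of_real t + l \<notin> resolvent_set D A"
      then have "complex_of_real t + l \<in> Spec D A - {l}" using t by (simp add: Spec_def)
      then have "d \<le> dist l (complex_of_real t + l)" unfolding assms(4) by (rule infdist_le)
      then show False using t by (simp add: dist_norm)
    qed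
    then show "complex_of_real t \<in> resolvent_set D B"
      unfolding B_def resolvent_set_shift .
  qed
  define K where "K = (1 + d / 4)\<^sup>2"
  have K: "K \<ge> 1" unfolding K_def using d by (intro one_le_power) simp
  \<comment> \<open>The two entries of the minimum are the smallness conditions of
    \<open>pencil_form_lower_bound\<close>.\<close>
  define \<rho> where "\<rho> = min (1 / 4) (\<delta>\<^sup>2 / (72 * K))"
  have \<rho>: "0 < \<rho>" "\<rho> \<le> 1 / 4" using assms(8) K by (auto simp: \<rho>_def)
  have \<rho>K: "72 * (K * \<rho>) \<le> \<delta>\<^sup>2"
  proof -
    have "72 * K * \<rho> \<le> 72 * K * (\<delta>\<^sup>2 / (72 * K))"
      using K by (intro mult_left_mono) (auto simp: \<rho>_def)
    then show ?thesis using K by (simp add: mult.assoc)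
  qed
  obtain N where N: "N \<ge> 1" and unif: "\<And>n u. n > N \<Longrightarrow> u \<in> cspan C \<Longrightarrow>
      norm (orth_proj (L n) u - u) \<le> \<rho> * norm u \<and>
      norm (\<Sum>j<n. cinner (B (orth_proj (L n) u)) (B (e n j)) *\<^sub>C e n j) \<le> \<rho>\<^sup>2 * norm u"
    using condition_H_uniform[OF sa l C(1) C(2)[unfolded EB] LD basis assms(7) \<rho>(1)]
    unfolding B_def by blast
  \<comment> \<open>The form bound \<open>\<delta>\<^sup>2 / 8\<close> divided by 3, the length
    allowed for the test vector.\<close>
  define c where "c = \<delta>\<^sup>2 / 24"
  have c: "c > 0" using assms(8) by (simp add: c_def)
  \<comment> \<open>Throughout the disk of radius \<open>d / 4\<close> about \<open>l\<close> the
    perturbation changes the pencil by at most \<open>c / 4\<close>. This leaves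
    \<open>3 * c / 4\<close> on the annulus, while at the centre the unperturbed pencil must stay
    below \<open>c / 2\<close> on the chosen vector.\<close>
  define \<epsilon> where "\<epsilon> = c / 4 / (1 + cmod l + d / 4)\<^sup>2"
  have l_pos: "0 < 1 + cmod l + d / 4" using d norm_ge_zero[of l] by linarith
  have \<epsilon>: "\<epsilon> > 0" using c l_pos by (simp add: \<epsilon>_def)
  have main: "(\<exists>\<zeta>. pencil_det M0 M1 M2 \<zeta> = 0 \<and> cmod (\<zeta> - l) < \<delta>) \<and>
      {\<mu>. pencil_det M0 M1 M2 \<mu> = 0} \<inter> {w. \<delta> < cmod (w - l) \<and> cmod (w - l) \<le> d / 4} = {}"
    if n: "n > N" and M: "M0 \<in> carrier_mat n n" "M1 \<in> carrier_mat n n" "M2 \<in> carrier_mat n n"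
      and close: "mat_norm (M0 - mat_A0 A e n) < \<epsilon>" "mat_norm (M1 - mat_A1 A e n) < \<epsilon>"
        "mat_norm (M2 - mat_A2 e n) < \<epsilon>" for n M0 M1 M2
  proof -
    let ?P = "pencil_mat M0 M1 M2"
    let ?T = "pencil_mat (mat_A0 A e n) (mat_A1 A e n) (mat_A2 e n)"
    let ?F = "e n ` {..<n}"
    have n1: "n \<ge> 1" using n by simp
    note bas = basis[OF n1]
    note os = orthonormal_basis_set[OF bas] and span = orthonormal_basis_span[OF bas]
      and proj = orthonormal_basis_proj[OF bas]
    have eL: "e n j \<in> L n" if "j < n" for j
      using that complex_vector.span_base[of "e n j" ?F] span by auto
    have eD: "e n j \<in> D" if "j < n" for j using eL[OF that] LD[OF n1] by blast
    have projL: "orth_proj (L n) y \<in> L n" for y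
      using orth_proj_in[OF os, of y] unfolding span .
    have A_car: "mat_A0 A e n \<in> carrier_mat n n" "mat_A1 A e n \<in> carrier_mat n n" "mat_A2 e n \<in> carrier_mat n n"
      by (simp_all add: mat_A0_def mat_A1_def mat_A2_def)
    define R where "R y = (\<Sum>j<n. cinner (B (orth_proj (L n) y)) (B (e n j)) *\<^sub>C e n j)" for y
    have R: "norm (R y) \<le> \<rho>\<^sup>2 * norm y" if "y \<in> cspan C" for y
      using unif[OF n that] by (simp add: R_def)
    \<comment> \<open>\<open>R y\<close> represents the functional on all of \<open>L n\<close>,
      because its coordinates record the values on the basis.\<close>
    have BR: "cinner (B (orth_proj (L n) y)) (B w) = cinner (R y) w" if w: "w \<in> L n" for y w
    proof -
      have wE: "w = (\<Sum>j<n. cinner w (e n j) *\<^sub>C e n j)"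
        using orth_proj_ident[OF os, of w] w unfolding span proj by simp
      have "B w = (\<Sum>j<n. cinner w (e n j) *\<^sub>C B (e n j))"
        by (subst wE, subst linear_operator_sum(2)[OF self_adjoint_linear[OF saB]])
          (auto intro!: sum.cong simp: lins eD)
      then have "cinner (B (orth_proj (L n) y)) (B w)
          = (\<Sum>j<n. cinner (e n j) w * cinner (B (orth_proj (L n) y)) (B (e n j)))"
        by (simp add: cinner_sum_right cinner_scaleC_right cinner_commute[symmetric])
      also have "\<dots> = cinner (R y) w"
        by (simp add: R_def cinner_sum_left cinner_scaleC_left mult.commute)
      finally show ?thesis .
    qed
    have H1: "norm (orth_proj (L n) y - y) \<le> \<rho> * norm y" if "y \<in> cspan C" for y
      using unif[OF n that] by blast
    have H3': "cmod (cinner (B (orth_proj (L n) y)) (B w)) \<le> \<rho>\<^sup>2 * norm y * norm w"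
      if "y \<in> cspan C" "w \<in> L n" for y w
      unfolding BR[OF that(2)]
      using norm_cinner_le[of "R y" w] mult_right_mono[OF R[OF that(1)] norm_ge_zero[of w]] by linarith
    have \<rho>2: "\<rho>\<^sup>2 \<le> \<rho>" using \<rho> by (simp add: power2_eq_square mult_left_le)
    have H3: "cmod (cinner (B (orth_proj (L n) y)) (B w)) \<le> \<rho> * norm y * norm w"
      if "y \<in> cspan C" "w \<in> L n" for y w
    proof -
      have "\<rho>\<^sup>2 * norm y * norm w \<le> \<rho> * norm y * norm w"
        using \<rho>2 by (intro mult_right_mono) auto
      then show ?thesis using H3'[OF that] by linarith
    qed
    \<comment> \<open>Testing the functional with the projected vector itself gives the squared
      norm, and \<rho> appears as the root of \<open>\<rho>\<^sup>2\<close>.\<close>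
    have H2: "norm (B (orth_proj (L n) y)) \<le> \<rho> * norm y" if "y \<in> cspan C" for y
    proof (rule power2_le_imp_le)
      have "(norm (B (orth_proj (L n) y)))\<^sup>2 \<le> \<rho>\<^sup>2 * norm y * norm (orth_proj (L n) y)"
        using H3'[OF that projL[of y]] unfolding cinner_self norm_of_real by simp
      also have "\<dots> \<le> \<rho>\<^sup>2 * norm y * norm y"
        using norm_orth_proj_le[OF os, of y] unfolding span by (intro mult_left_mono) auto
      finally show "(norm (B (orth_proj (L n) y)))\<^sup>2 \<le> (\<rho> * norm y)\<^sup>2"
        by (simp add: power2_eq_square mult_ac)
      show "0 \<le> \<rho> * norm y" using \<rho> by simp
    qed
    have T_lower: "c * euclidean_norm v \<le> euclidean_norm (?T z *\<^sub>v v)"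
      if v: "v \<in> carrier_vec n" and z: "\<delta> \<le> cmod (z - l)" "cmod (z - l) \<le> d / 4" for z v
    proof -
      define x where "x = (\<Sum>k<n. cnj (vec_index v k) *\<^sub>C e n k)"
      have x: "x \<in> L n"
        unfolding x_def span[symmetric]
        by (intro complex_vector.span_sum complex_vector.span_scale complex_vector.span_base) simp
      have "\<exists>w\<in>cspan ?F. norm w \<le> 3 * norm x \<and> \<delta>\<^sup>2 / 8 * (norm x)\<^sup>2 \<le> cmod (pencil_form B (z - l) w x)"
        using \<rho> \<rho>K LD[OF n1] x H1 H2 H3
        by (intro pencil_form_lower_bound[OF saB gap C os _ _ _ _ _ z assms(8), where \<rho> = \<rho>])
          (simp_all add: span K_def)
      then obtain w where "w \<in> L n" "norm w \<le> 3 * norm x"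
        "\<delta>\<^sup>2 / 8 * (norm x)\<^sup>2 \<le> cmod (pencil_form B (z - l) w x)"
        unfolding span by blast
      from pencil_mat_lower_bound[where e = e, OF sa l bas LD[OF n1] v x_def this[unfolded B_def]]
      show ?thesis by (simp add: c_def)
    qed
    have Pv: "?P z *\<^sub>v v \<in> carrier_vec n" and Tv: "?T z *\<^sub>v v \<in> carrier_vec n"
      if "v \<in> carrier_vec n" for z v
      using that by (simp_all add: mult_mat_vec_carrier[OF pencil_mat_carrier[OF M]]
          mult_mat_vec_carrier[OF pencil_mat_carrier[OF A_car]])
    have pert: "euclidean_norm (?P z *\<^sub>v v - ?T z *\<^sub>v v) \<le> c / 4 * euclidean_norm v"
      if v: "v \<in> carrier_vec n" and z: "cmod (z - l) \<le> d / 4" for z v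
    proof -
      have "cmod z \<le> cmod l + d / 4" using norm_triangle_sub[of z l] z by linarith
      then have "\<epsilon> * (1 + cmod z)\<^sup>2 \<le> \<epsilon> * (1 + cmod l + d / 4)\<^sup>2"
        using \<epsilon> by (intro mult_left_mono power_mono) auto
      also have "\<dots> = c / 4" using l_pos by (simp add: \<epsilon>_def)
      finally have "\<epsilon> * (1 + cmod z)\<^sup>2 * euclidean_norm v \<le> c / 4 * euclidean_norm v"
        by (rule mult_right_mono[OF _ euclidean_norm_nonneg])
      then show ?thesis
        using pencil_mat_perturbation[OF M A_car _ _ _ v, of \<epsilon> z] close by linarith
    qed
    \<comment> \<open>The inner circle is included, since it is the boundary on which the maximum
      modulus argument needs the bound.\<close>
    have P_lower: "3 * c / 4 * euclidean_norm v \<le> euclidean_norm (?P z *\<^sub>v v)"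
      if v: "v \<in> carrier_vec n" and z: "\<delta> \<le> cmod (z - l)" "cmod (z - l) \<le> d / 4" for z v
    proof -
      have "euclidean_norm (?T z *\<^sub>v v) \<le> euclidean_norm (?P z *\<^sub>v v) + c / 4 * euclidean_norm v"
        using euclidean_norm_triangle_diff[OF Tv[OF v] Pv[OF v], of z z] pert[OF v z(2)]
        by (simp add: euclidean_norm_minus_commute[OF Tv[OF v] Pv[OF v]])
      then show ?thesis using T_lower[OF v z] by simp
    qed
    have c34: "0 < 3 * c / 4" using c by simp
    have "{\<mu>. pencil_det M0 M1 M2 \<mu> = 0} \<inter> {w. \<delta> < cmod (w - l) \<and> cmod (w - l) \<le> d / 4} = {}"
      using pencil_det_nonzero[OF M c34] P_lower by fastforce
    moreover have "\<exists>\<zeta>. pencil_det M0 M1 M2 \<zeta> = 0 \<and> cmod (\<zeta> - l) < \<delta>"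
    proof (rule pencil_det_zero_in_ball[OF M assms(8) c34])
      show "3 * c / 4 * euclidean_norm v \<le> euclidean_norm (?P z *\<^sub>v v)"
        if "cmod (z - l) = \<delta>" "v \<in> carrier_vec n" for z v
        using P_lower[OF that(2)] that(1) assms(9) by simp
      \<comment> \<open>The conjugates make \<open>v\<close> the coordinate vector that corresponds
        to the projection of \<open>u\<close>, as the matrices act through the antilinear
        argument.\<close>
      define v where "v = Matrix.vec n (\<lambda>k. cnj (cinner u (e n k)))"
      show v: "v \<in> carrier_vec n" by (simp add: v_def)
      have uC: "u \<in> cspan C" using u(1) C(2) EB by simp
      have proj_u: "orth_proj (L n) u = (\<Sum>k<n. cnj (vec_index v k) *\<^sub>C e n k)"
        unfolding proj by (intro sum.cong) (auto simp: v_def)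
      have nv: "euclidean_norm v = norm (orth_proj (L n) u)"
        unfolding proj_u orthonormal_basis_norm[OF bas] euclidean_norm_carrier[OF v] by simp
      \<comment> \<open>At the centre \<open>s = 0\<close>, so only the first term of the form
        remains; the entries are the conjugated coordinates of \<open>R u\<close>.\<close>
      have "vec_index (?T l *\<^sub>v v) j = cnj (cinner (B (orth_proj (L n) u)) (B (e n j)))" if "j < n" for j
        using pencil_mat_mult_vec[where e = e, OF sa l eD v that, of l]
        unfolding proj_u[symmetric] B_def[symmetric] pencil_form_def
        by (simp add: cinner_commute[symmetric] del: index_mult_mat_vec)
      then have "euclidean_norm (?T l *\<^sub>v v) = norm (R u)"
        unfolding R_def orthonormal_basis_norm[OF bas] euclidean_norm_carrier[OF Tv[OF v]]
        by (intro L2_set_cong) (simp_all del: index_mult_mat_vec)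
      then have "euclidean_norm (?T l *\<^sub>v v) \<le> \<rho>\<^sup>2 * norm u" using R[OF uC] by simp
      also have "\<dots> < c / 2 * euclidean_norm v"
      proof -
        have "norm u \<le> norm (orth_proj (L n) u) + norm (orth_proj (L n) u - u)"
          using norm_triangle_ineq4[of "orth_proj (L n) u" "orth_proj (L n) u - u"] by simp
        moreover have "\<rho> * norm u \<le> 1 / 4 * norm u" using \<rho> by (intro mult_right_mono) auto
        ultimately have nv34: "3 / 4 * norm u \<le> euclidean_norm v" using H1[OF uC] nv by linarith
        have "72 * \<rho> \<le> 72 * (K * \<rho>)" using K \<rho> by simp
        then have "72 * \<rho> \<le> \<delta>\<^sup>2" using \<rho>K by linarith
        moreover have "\<rho>\<^sup>2 \<le> 1 / 4 * \<rho>" unfolding power2_eq_square using \<rho> by (intro mult_right_mono) auto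
        ultimately have "\<rho>\<^sup>2 \<le> \<delta>\<^sup>2 / 288" by linarith
        \<comment> \<open>The right-hand side is \<open>\<delta>\<^sup>2 / 64\<close>; the factor
          3/4 accounts for the length that \<open>u\<close> may lose under projection.\<close>
        then have "\<rho>\<^sup>2 < c / 2 * (3 / 4)" unfolding c_def using assms(8) zero_less_power[of \<delta> 2] by linarith
        then have "\<rho>\<^sup>2 * norm u < c / 2 * (3 / 4) * norm u"
          using u(2) by (intro mult_strict_right_mono) auto
        also have "\<dots> \<le> c / 2 * euclidean_norm v"
          using mult_left_mono[OF nv34, of "c / 2"] c by simp
        finally show ?thesis .
      qed
      finally show "euclidean_norm (?P l *\<^sub>v v) < 3 * c / 4 * euclidean_norm v"
        using euclidean_norm_triangle_diff[OF Pv[OF v] Tv[OF v], of l l] pert[OF v, of l] d by simp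
    qed
    ultimately show ?thesis by blast
  qed
  show ?thesis
  proof (intro exI[of _ N] exI[of _ \<epsilon>] conjI)
    show "N > 0" using N by simp
  qed (use \<epsilon> main in blast)+
qed

end
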